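(* Consider the hyperbolic system $\partial_t\mathbf{u}+\partial_xf(\mathbf{u})=0$ for $\mathbf{u}=(u,v)^T$ (velocity $u$ and specific volume $v$ of a fluid) with flux function and pressure $$f(\mathbf{u})=\begin{pmatrix}p(v)\\-u\end{pmatrix},\qquad p(v)=\begin{cases}v^{-\gamma_1}&\text{if }v<v_*,\\ v^{-\gamma_2}+\Delta v_*&\text{if }v>v_*,\end{cases}$$ where $\Delta v_*=v_*^{-\gamma_1}-v_*^{-\gamma_2}$ is chosen such that the pressure law is Lipschitz continuous, and where the pressure satisfies $p'_-(v_* )<p'_+(v_* )$ (one-sided derivatives at $v_*$) and $p'(v)<0$, $p''(v)>0$ for $v\neq v_*$. Assume a Haar-type expansion (see context) with gPC modes $\hat v_*$ and $\widehat{\Delta v_*}$ that account for a random state $v_*(\xi)$. Then a stochastic Galerkin formulation to this system, describing the gPC modes $\hat{\mathbf{u}}:=(\hat u,\hat v)^T$ for $\hat u\in\mathbb{R}^{K+1}$ and $\hat v\in\mathbb{H}^+$, reads as $$\partial_t\hat{\mathbf{u}}+\partial_x\hat f(\hat{\mathbf{u}})=\vec 0\qquad\text{with flux function}\qquad \hat f(\hat{\mathbf{u}})=\begin{pmatrix}\hat p(\hat v)\\-\hat u\end{pmatrix}$$ and pressure law $$\hat p(\hat v)=-\tfrac12\big[\hat s(\hat v-\hat v_* )-\hat e_1\big]\ast\widehat{v^{-\gamma_1}}+\tfrac12\big[\hat s(\hat v-\hat v_* )+\hat e_1\big]\ast\big(\widehat{v^{-\gamma_2}}+\widehat{\Delta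 v_*}\big).$$ Furthermore, the generalized spectrum is $\sigma\big\{\mathrm{D}_{\hat{\mathbf{u}}}\hat f(\hat{\mathbf{u}})\big\}=\big\{\pm\mathcal{D}_{p'}^{1/2}(\hat v)\big\}$ with $$\mathcal{D}_{p'}^{1/2}(\hat v):=\tfrac{\sqrt{\gamma_1}}2\Big[\mathcal{D}\big(\hat s(\hat v-\hat v_* )\big)-I\Big]\mathcal{D}^{-\frac{\gamma_1+1}2}(\hat v)-\tfrac{\sqrt{\gamma_2}}2\Big[\mathcal{D}\big(\hat s(\hat v-\hat v_* )\big)+I\Big]\mathcal{D}^{-\frac{\gamma_2+1}2}(\hat v).$$
   Context: Haar-type expansion. Let $K\in\mathbb{N}_0$ and let $\xi\sim\mathcal{U}(0,1)$ be uniformly distributed, with law $\mathbb{P}$; write $\langle f,g\rangle_{\mathbb{P}}=\mathbb{E}[f(\xi)g(\xi)]$. Matrix and vector indices run over $0,\dots,K$. The canonical Haar matrix $A_c\in\mathbb{R}^{(K+1)\times(K+1)}$ has all entries equal to $1$ in row $0$; for $i=1,\dots,K$, row $i$ has zeros in columns $0,\dots,i-2$, the entry $h^d_i=s_ih^r_i$ in column $i-1$, and the entry $h^r_i=\sqrt{(K+1)/(s_i^2-s_i)}$ in columns $i,\dots,K$, where $s_i=-(K+1-i)$. A Haar-type matrix is $A=\begin{pmatrix}1&0\\0&O\end{pmatrix}A_c$ with an orthogonal matrix $O\in\mathbb{R}^{K\times K}$; it satisfies $AA^T=(K+1)I$. Its basis functions are $\phi_k(\xi)=\sum_{\ell=0}^K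 A_{k\ell}\,\chi_{[0,1]}((K+1)\xi-\ell)$, $k=0,\dots,K$, where $\chi_{[0,1]}$ is the indicator function of $[0,1]$; they are orthonormal in $L^2(\mathbb{P})$. Put $\mathcal{H}:=A/\sqrt{K+1}$, an orthogonal matrix. gPC modes $\hat w\in\mathbb{R}^{K+1}$ are the coefficients of a truncated expansion $\sum_{k=0}^K\hat w_k\phi_k(\xi)$ approximating a random quantity; $\hat v_*$ and $\widehat{\Delta v_*}$ are the modes belonging to $v_*(\xi)$ and $\Delta v_*(\xi)$. The stochastic Galerkin matrix is $\mathcal{P}(\hat w)=\sum_{k=0}^K\hat w_k\mathcal{M}_k$ with $\mathcal{M}_k=(\langle\phi_k,\phi_i\phi_j\rangle_{\mathbb{P}})_{i,j=0,\dots,K}$, and the Galerkin product (representing products of random quantities) is $\hat w\ast\hat q=\mathcal{P}(\hat w)\hat q$; $\hat e_1=(1,0,\dots,0)^T\in\mathbb{R}^{K+1}$ and $I$ is the identity matrix. For Haar-type expansions $\mathcal{P}(\hat w)=\mathcal{H}\mathcal{D}(\hat w)\mathcal{H}^T$ with $\mathcal{D}(\hat w)$ a diagonal matrix of eigenvalues. $\mathbb{H}^+$ is the set of $\hat w\in\mathbb{R}^{K+1}$ for which $\mathcal{P}(\hat w)$ is strictly positive definite. Powers and signs of diagonal matrices are taken entrywise on the diagonal. The modes of the sign are $\hat s(\hat w):=\mathcal{H}\,\operatorname{sign}\{\mathcal{D}(\hat w)\}\,\mathcal{H}^T\hat e_1$, and the modes of the powers are $\widehat{v^{-\gamma_i}}=\mathcal{H}\,\mathcal{D}(\hat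 v)^{-\gamma_i}\,\mathcal{H}^T\hat e_1$. $\mathrm{D}_{\hat{\mathbf{u}}}$ denotes the (generalized) Jacobian with respect to $\hat{\mathbf{u}}$. A spectrum written as a set of diagonal matrices means: the eigenvalues are the diagonal entries of these $(K+1)\times(K+1)$ matrices.
   Formalization: Where an eigenvalue of v̂−v̂_* vanishes, the sign in the spectrum formula is read as set-valued (sgn 0 = [−1,1]), since the generalized Jacobian is then a non-trivial convex set; the random state v_*(ξ) is taken as its truncated gPC expansion, positive. *)

theory Defs
  imports "HOL-Analysis.Analysis" "HOL-Computational_Algebra.Computational_Algebra"
begin

text \<open>
  Vectors and matrices with indices \<open>0, \<dots>, K\<close> are indexed by a finite linearly ordered type
  \<open>'n\<close> with \<open>CARD('n) = K + 1\<close>; \<open>pos i\<close> is the numerical index of \<open>i\<close>.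
\<close>

type_synonym 'n rvec = "(real, 'n) vec"
type_synonym 'n rmat = "((real, 'n) vec, 'n) vec"

definition pos :: "'n::{finite,linorder} \<Rightarrow> nat" where
  "pos i = card {j. j < i}"

definition e1 :: "'n::{finite,linorder} rvec" where
  "e1 = (\<chi> i. if pos i = 0 then 1 else 0)"

definition haar_s :: "nat \<Rightarrow> nat \<Rightarrow> real" where
  "haar_s K i = - (real K + 1 - real i)"

definition haar_hr :: "nat \<Rightarrow> nat \<Rightarrow> real" where
  "haar_hr K i = sqrt ((real K + 1) / ((haar_s K i)\<^sup>2 - haar_s K i))"

definition haar_hd :: "nat \<Rightarrow> nat \<Rightarrow> real" where
  "haar_hd K i = haar_s K i * haar_hr K i"

definition haar_entry :: "nat \<Rightarrow> nat \<Rightarrow> nat \<Rightarrow> real" where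
  "haar_entry K i j =
     (if i = 0 then 1
      else if j + 1 < i then 0
      else if j + 1 = i then haar_hd K i
      else haar_hr K i)"

definition canonical_haar :: "'n::{finite,linorder} rmat" where
  "canonical_haar = (\<chi> i j. haar_entry (CARD('n) - 1) (pos i) (pos j))"

text \<open>
  \<open>Q\<close> is the block diagonal matrix with blocks \<open>1\<close> and \<open>O\<close>; it is orthogonal iff the
  \<open>K \<times> K\<close> block \<open>O\<close> is.
\<close>

definition haar_type :: "'n::{finite,linorder} rmat \<Rightarrow> bool" where
  "haar_type A \<longleftrightarrow>
     (\<exists>Q. orthogonal_matrix Q \<and>
          (\<forall>i j. pos i = 0 \<or> pos j = 0 \<longrightarrow> Q $ i $ j = (if i = j then 1 else 0)) \<and>
          A = Q ** canonical_haar)"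

definition unif01 :: "real measure" where
  "unif01 = uniform_measure lborel {0..1}"

definition ip :: "(real \<Rightarrow> real) \<Rightarrow> (real \<Rightarrow> real) \<Rightarrow> real" where
  "ip f g = (\<integral>\<xi>. f \<xi> * g \<xi> \<partial>unif01)"

definition basis_fun :: "'n::{finite,linorder} rmat \<Rightarrow> 'n \<Rightarrow> real \<Rightarrow> real" where
  "basis_fun A k \<xi> =
     (\<Sum>l\<in>UNIV. A $ k $ l * indicat_real {0..1} (real CARD('n) * \<xi> - real (pos l)))"

definition expansion :: "'n::{finite,linorder} rmat \<Rightarrow> 'n rvec \<Rightarrow> real \<Rightarrow> real" where
  "expansion A w \<xi> = (\<Sum>k\<in>UNIV. w $ k * basis_fun A k \<xi>)"

definition modes :: "'n::{finite,linorder} rmat \<Rightarrow> (real \<Rightarrow> real) \<Rightarrow> 'n rvec" where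
  "modes A g = (\<chi> k. ip g (basis_fun A k))"

definition scaled_haar :: "'n::{finite,linorder} rmat \<Rightarrow> 'n rmat" where
  "scaled_haar A = (1 / sqrt (real CARD('n))) *\<^sub>R A"

definition triple_matrix :: "'n::{finite,linorder} rmat \<Rightarrow> 'n \<Rightarrow> 'n rmat" where
  "triple_matrix A k =
     (\<chi> i j. ip (basis_fun A k) (\<lambda>\<xi>. basis_fun A i \<xi> * basis_fun A j \<xi>))"

definition galerkin_matrix :: "'n::{finite,linorder} rmat \<Rightarrow> 'n rvec \<Rightarrow> 'n rmat" where
  "galerkin_matrix A w = (\<Sum>k\<in>UNIV. w $ k *\<^sub>R triple_matrix A k)"

definition galerkin_prod :: "'n::{finite,linorder} rmat \<Rightarrow> 'n rvec \<Rightarrow> 'n rvec \<Rightarrow> 'n rvec" where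
  "galerkin_prod A w q = galerkin_matrix A w *v q"

text \<open>
  The relation \<open>P(w) = H D(w) H\<^sup>T\<close> with orthogonal \<open>H\<close> determines \<open>D(w)\<close>, and is solved for it here.
\<close>

definition eig_matrix :: "'n::{finite,linorder} rmat \<Rightarrow> 'n rvec \<Rightarrow> 'n rmat" where
  "eig_matrix A w = transpose (scaled_haar A) ** galerkin_matrix A w ** scaled_haar A"

definition diag_map :: "(real \<Rightarrow> real) \<Rightarrow> real ^ 'n ^ 'n \<Rightarrow> real ^ 'n ^ 'n" where
  "diag_map g M = (\<chi> i j. if i = j then g (M $ i $ i) else 0)"

definition diag_modes :: "'n::{finite,linorder} rmat \<Rightarrow> 'n rmat \<Rightarrow> 'n rvec" where
  "diag_modes A M = (scaled_haar A ** M ** transpose (scaled_haar A)) *v e1"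

definition sign_modes :: "'n::{finite,linorder} rmat \<Rightarrow> 'n rvec \<Rightarrow> 'n rvec" where
  "sign_modes A w = diag_modes A (diag_map sgn (eig_matrix A w))"

definition power_modes :: "'n::{finite,linorder} rmat \<Rightarrow> real \<Rightarrow> 'n rvec \<Rightarrow> 'n rvec" where
  "power_modes A a v = diag_modes A (diag_map (\<lambda>x. x powr a) (eig_matrix A v))"

definition strictly_pos_def :: "real ^ 'n ^ 'n \<Rightarrow> bool" where
  "strictly_pos_def M \<longleftrightarrow> transpose M = M \<and> (\<forall>x. x \<noteq> 0 \<longrightarrow> 0 < x \<bullet> (M *v x))"

definition Hplus :: "'n::{finite,linorder} rmat \<Rightarrow> ('n rvec) set" where
  "Hplus A = {w. strictly_pos_def (galerkin_matrix A w)}"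

text \<open>The value at \<open>v = vs\<close> is the common limit \<open>vs powr (-\<gamma>\<^sub>1)\<close>.\<close>

definition pressure_jump :: "real \<Rightarrow> real \<Rightarrow> real \<Rightarrow> real" where
  "pressure_jump \<gamma>\<^sub>1 \<gamma>\<^sub>2 vs = vs powr (- \<gamma>\<^sub>1) - vs powr (- \<gamma>\<^sub>2)"

definition pressure :: "real \<Rightarrow> real \<Rightarrow> real \<Rightarrow> real \<Rightarrow> real" where
  "pressure \<gamma>\<^sub>1 \<gamma>\<^sub>2 vs v =
     (if v < vs then v powr (- \<gamma>\<^sub>1) else v powr (- \<gamma>\<^sub>2) + pressure_jump \<gamma>\<^sub>1 \<gamma>\<^sub>2 vs)"

definition flux :: "real \<Rightarrow> real \<Rightarrow> real \<Rightarrow> real \<times> real \<Rightarrow> real \<times> real" where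
  "flux \<gamma>\<^sub>1 \<gamma>\<^sub>2 vs = (\<lambda>(u, v). (pressure \<gamma>\<^sub>1 \<gamma>\<^sub>2 vs v, - u))"

definition random_flux ::
    "'n::{finite,linorder} rmat \<Rightarrow> real \<Rightarrow> real \<Rightarrow> 'n rvec \<Rightarrow> real \<Rightarrow> real \<times> real \<Rightarrow> real \<times> real" where
  "random_flux A \<gamma>\<^sub>1 \<gamma>\<^sub>2 vs \<xi> = flux \<gamma>\<^sub>1 \<gamma>\<^sub>2 (expansion A vs \<xi>)"

definition admissible_pressure :: "real \<Rightarrow> real \<Rightarrow> real \<Rightarrow> bool" where
  "admissible_pressure \<gamma>\<^sub>1 \<gamma>\<^sub>2 vs \<longleftrightarrow>
     (\<exists>p_left p_right.
        (pressure \<gamma>\<^sub>1 \<gamma>\<^sub>2 vs has_real_derivative p_left) (at_left vs) \<and>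
        (pressure \<gamma>\<^sub>1 \<gamma>\<^sub>2 vs has_real_derivative p_right) (at_right vs) \<and>
        p_left < p_right) \<and>
     (\<forall>v>0. v \<noteq> vs \<longrightarrow>
        deriv (pressure \<gamma>\<^sub>1 \<gamma>\<^sub>2 vs) v < 0 \<and>
        deriv (deriv (pressure \<gamma>\<^sub>1 \<gamma>\<^sub>2 vs)) v > 0)"

text \<open>The modes of \<open>(u, v)\<close> are stacked, with \<open>u\<close> in the left and \<open>v\<close> in the right summand.\<close>

definition stack :: "real ^ 'n \<Rightarrow> real ^ 'n \<Rightarrow> real ^ ('n + 'n)" where
  "stack u v = (\<chi> i. case i of Inl k \<Rightarrow> u $ k | Inr k \<Rightarrow> v $ k)"

definition ublock :: "real ^ ('n + 'n) \<Rightarrow> real ^ 'n" where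
  "ublock w = (\<chi> k. w $ Inl k)"

definition vblock :: "real ^ ('n + 'n) \<Rightarrow> real ^ 'n" where
  "vblock w = (\<chi> k. w $ Inr k)"

definition state_expansion ::
    "'n::{finite,linorder} rmat \<Rightarrow> real ^ ('n + 'n) \<Rightarrow> real \<Rightarrow> real \<times> real" where
  "state_expansion A w \<xi> = (expansion A (ublock w) \<xi>, expansion A (vblock w) \<xi>)"

definition state_modes ::
    "'n::{finite,linorder} rmat \<Rightarrow> (real \<Rightarrow> real \<times> real) \<Rightarrow> real ^ ('n + 'n)" where
  "state_modes A G = stack (modes A (\<lambda>\<xi>. fst (G \<xi>))) (modes A (\<lambda>\<xi>. snd (G \<xi>)))"

text \<open>Galerkin projection of a random flux function \<open>F \<xi>\<close>.\<close>

definition projected_flux ::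
    "'n::{finite,linorder} rmat \<Rightarrow> (real \<Rightarrow> real \<times> real \<Rightarrow> real \<times> real) \<Rightarrow>
     real ^ ('n + 'n) \<Rightarrow> real ^ ('n + 'n)" where
  "projected_flux A F w = state_modes A (\<lambda>\<xi>. F \<xi> (state_expansion A w \<xi>))"

text \<open>The equation \<open>\<partial>\<^sub>t Q + \<partial>\<^sub>x G = 0\<close> on \<open>\<Omega>\<close>, for fields \<open>Q\<close>, \<open>G\<close> of the arguments \<open>t\<close>, \<open>x\<close>.\<close>

definition conservation_eq ::
    "(real \<times> real) set \<Rightarrow> (real \<Rightarrow> real \<Rightarrow> 'a::real_normed_vector) \<Rightarrow>
     (real \<Rightarrow> real \<Rightarrow> 'a) \<Rightarrow> bool" where
  "conservation_eq \<Omega> Q G \<longleftrightarrow>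
     (\<forall>(t, x) \<in> \<Omega>. \<exists>Qt Gx.
        ((\<lambda>\<tau>. Q \<tau> x) has_vector_derivative Qt) (at t) \<and>
        ((\<lambda>y. G t y) has_vector_derivative Gx) (at x) \<and>
        Qt + Gx = 0)"

text \<open>
  The expanded state is inserted into \<open>\<partial>\<^sub>t u + \<partial>\<^sub>x F(\<xi>, u) = 0\<close>, and the equation is tested with
  every basis function.
\<close>

definition galerkin_system ::
    "'n::{finite,linorder} rmat \<Rightarrow> (real \<Rightarrow> real \<times> real \<Rightarrow> real \<times> real) \<Rightarrow>
     (real \<times> real) set \<Rightarrow> (real \<Rightarrow> real \<Rightarrow> real ^ ('n + 'n)) \<Rightarrow> bool" where
  "galerkin_system A F \<Omega> U \<longleftrightarrow>
     conservation_eq \<Omega>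
       (\<lambda>t x. state_modes A (state_expansion A (U t x)))
       (\<lambda>t x. projected_flux A F (U t x))"

definition pressure_modes ::
    "'n::{finite,linorder} rmat \<Rightarrow> real \<Rightarrow> real \<Rightarrow> 'n rvec \<Rightarrow> 'n rvec \<Rightarrow>
     'n rvec \<Rightarrow> 'n rvec" where
  "pressure_modes A \<gamma>\<^sub>1 \<gamma>\<^sub>2 vs dvs v =
     - (1 / 2) *\<^sub>R galerkin_prod A (sign_modes A (v - vs) - e1) (power_modes A (- \<gamma>\<^sub>1) v) +
     (1 / 2) *\<^sub>R galerkin_prod A (sign_modes A (v - vs) + e1) (power_modes A (- \<gamma>\<^sub>2) v + dvs)"

definition flux_modes ::
    "'n::{finite,linorder} rmat \<Rightarrow> real \<Rightarrow> real \<Rightarrow> 'n rvec \<Rightarrow> 'n rvec \<Rightarrow>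
     real ^ ('n + 'n) \<Rightarrow> real ^ ('n + 'n)" where
  "flux_modes A \<gamma>\<^sub>1 \<gamma>\<^sub>2 vs dvs w =
     stack (pressure_modes A \<gamma>\<^sub>1 \<gamma>\<^sub>2 vs dvs (vblock w)) (- ublock w)"

text \<open>Clarke's generalized Jacobian.\<close>

definition gen_jacobian :: "(real ^ 'm \<Rightarrow> real ^ 'm) \<Rightarrow> real ^ 'm \<Rightarrow> (real ^ 'm ^ 'm) set" where
  "gen_jacobian F w = convex hull
     {J. \<exists>X. (\<forall>n. F differentiable (at (X n))) \<and> X \<longlonglongrightarrow> w \<and>
             (\<lambda>n. jacobian F (at (X n))) \<longlonglongrightarrow> J}"

definition char_poly_of :: "real ^ 'm ^ 'm \<Rightarrow> complex poly" where
  "char_poly_of J = det (mat [:0, 1:] - (\<chi> i j. [:complex_of_real (J $ i $ j):]))"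

text \<open>Complex eigenvalues, counted with algebraic multiplicity.\<close>

definition spectrum_of :: "real ^ 'm ^ 'm \<Rightarrow> complex multiset" where
  "spectrum_of J = proots (char_poly_of J)"

definition pm_diag :: "real ^ 'n ^ 'n \<Rightarrow> complex multiset" where
  "pm_diag M = (\<Sum>i\<in>UNIV. {# complex_of_real (M $ i $ i), - complex_of_real (M $ i $ i) #})"

text \<open>
  At a point where an eigenvalue of \<open>v - vs\<close> vanishes, the generalized Jacobian is not a single
  matrix. The sign is then understood as the set-valued sign (the generalized gradient of the
  absolute value), applied entrywise to the eigenvalues.
\<close>

definition gen_sgn :: "real \<Rightarrow> real set" where
  "gen_sgn x = (if x = 0 then {-1..1} else {sgn x})"

definition gen_sign_modes :: "'n::{finite,linorder} rmat \<Rightarrow> 'n rvec \<Rightarrow> ('n rvec) set" where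
  "gen_sign_modes A w =
     {diag_modes A S | S.
        (\<forall>i j. i \<noteq> j \<longrightarrow> S $ i $ j = 0) \<and> (\<forall>i. S $ i $ i \<in> gen_sgn (eig_matrix A w $ i $ i))}"

text \<open>The argument \<open>s\<close> stands for modes of the sign of \<open>v - vs\<close>.\<close>

definition Dp_half ::
    "'n::{finite,linorder} rmat \<Rightarrow> real \<Rightarrow> real \<Rightarrow> 'n rvec \<Rightarrow> 'n rvec \<Rightarrow> 'n rmat" where
  "Dp_half A \<gamma>\<^sub>1 \<gamma>\<^sub>2 s v =
     (sqrt \<gamma>\<^sub>1 / 2) *\<^sub>R ((eig_matrix A s - mat 1) **
        diag_map (\<lambda>x. x powr (- (\<gamma>\<^sub>1 + 1) / 2)) (eig_matrix A v)) -
     (sqrt \<gamma>\<^sub>2 / 2) *\<^sub>R ((eig_matrix A s + mat 1) **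
        diag_map (\<lambda>x. x powr (- (\<gamma>\<^sub>2 + 1) / 2)) (eig_matrix A v))"

end

theory Submission
  imports Defs
begin

text \<open>
  Rows of a Haar-type matrix are orthogonal, so the basis functions are, up to normalisation, an
  orthogonal change of basis away from the indicators of the \<open>K + 1\<close> cells. In terms of the cell
  values \<open>A\<^sup>T w\<close> every Galerkin operation acts entrywise, and \<open>D(w)\<close> is the diagonal matrix of the
  cell values. Hence the flux is, up to a linear change of variables, the scalar pressure law in
  every cell. Limits of its Jacobians are block matrices with off-diagonal blocks similar to
  \<open>diag c\<close> and equal to \<open>-I\<close>, where each \<open>c\<^sub>l\<close> is a one-sided slope; the generalized Jacobian fills
  in the box of all slopes between them, and the eigenvalues for \<open>c\<close> are the square roots of
  \<open>- c\<^sub>l\<close>.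
\<close>

text \<open>A spectrum is not linear in its matrix, so the convex hull in the generalized Jacobian
  must be known exactly before eigenvalues can be computed. This is possible because
  \<open>J\<close> depends affinely on the slopes and because the kinks of different cells can be
  approached independently from either side: every vertex of the box of slopes occurs as a limit,
  and nothing else does. The latter holds because a point of differentiability of the flux lies on
  no kink, which rests on the two one-sided slopes being different and on the invertible change of
  variables that leads from the flux back to each scalar law. The hull interpolates slopes linearly,
  whereas \<open>Dp_half\<close> is linear in the sign and hence interpolates speeds, whose squares
  are minus the slopes. At a kink these two parametrisations differ, but both sweep the same
  interval, one cell at a time. The spectra therefore agree as sets over the set-valued sign, not
  for equal interpolation weights.\<close>

no_notation fps_nth (infixl "$" 75)

section \<open>Orthogonality of Haar-type matrices\<close>

lemma pos_strict_mono: "i < j \<Longrightarrow> pos i < pos j"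
  unfolding pos_def by (rule psubset_card_mono) (auto dest: less_trans)

lemma inj_pos: "inj pos"
  by (rule injI) (metis linorder_less_linear order_less_irrefl pos_strict_mono)

lemma pos_less_card: "pos (i::'n::{finite,linorder}) < CARD('n)"
  unfolding pos_def by (rule psubset_card_mono) auto

lemma bij_pos: "bij_betw pos (UNIV :: 'n::{finite,linorder} set) {..<CARD('n)}"
proof -
  have "pos ` (UNIV :: 'n set) = {..<CARD('n)}"
    by (rule card_subset_eq) (auto simp: card_image[OF inj_pos] pos_less_card)
  then show ?thesis using inj_pos by (simp add: bij_betw_def)
qed

lemma sum_pos:
  "(\<Sum>l\<in>(UNIV :: 'n::{finite,linorder} set). f (pos l)) = sum f {..<CARD('n)}"
  using sum.reindex_bij_betw[OF bij_pos] .

lemma haar_norm_factor: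
  assumes "1 \<le> i" "i \<le> K"
  shows "(haar_hr K i)\<^sup>2 * ((haar_s K i)\<^sup>2 - haar_s K i) = real K + 1"
proof -
  have s: "haar_s K i \<le> -1" using assms unfolding haar_s_def by simp
  then have "(haar_s K i)\<^sup>2 - haar_s K i > 0"
    by (smt (verit) zero_le_power2)
  then show ?thesis unfolding haar_hr_def by simp
qed

text \<open>The three terms collect the columns before, at and after \<open>i - 1\<close>. A general
  \<open>g\<close> serves both the norm of a row (squares) and its orthogonality to earlier rows
  (multiples).\<close>

lemma haar_row_sum:
  assumes "1 \<le> i" "i \<le> K"
  shows "(\<Sum>l<Suc K. g (haar_entry K i l)) =
    real (i - 1) * g 0 + g (haar_hd K i) + (real K + 1 - real i) * g (haar_hr K i)"
proof -
  have "{..<Suc K} = {..<i - 1} \<union> {i - 1} \<union> {i..<Suc K}" using assms by auto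
  moreover have "(\<Sum>l\<in>{..<i - 1} \<union> {i - 1} \<union> {i..<Suc K}. g (haar_entry K i l)) =
     (\<Sum>l<i - 1. g (haar_entry K i l)) + g (haar_entry K i (i - 1)) + (\<Sum>l=i..<Suc K. g (haar_entry K i l))"
    using assms by (subst sum.union_disjoint; auto)+
  moreover have "(\<Sum>l<i - 1. g (haar_entry K i l)) = (\<Sum>l<i - 1. g 0)"
    by (rule sum.cong) (use assms in \<open>auto simp: haar_entry_def\<close>)
  moreover have "(\<Sum>l=i..<Suc K. g (haar_entry K i l)) = (\<Sum>l=i..<Suc K. g (haar_hr K i))"
    by (rule sum.cong) (use assms in \<open>auto simp: haar_entry_def\<close>)
  ultimately show ?thesis using assms
    by (simp add: haar_entry_def of_nat_diff algebra_simps)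
qed

lemma haar_row_norm:
  assumes "i \<le> K"
  shows "(\<Sum>l<Suc K. haar_entry K i l * haar_entry K i l) = real K + 1"
proof (cases "i = 0")
  case True then show ?thesis by (simp add: haar_entry_def)
next
  case False
  then have i: "1 \<le> i" by simp
  \<comment> \<open>Since \<open>K + 1 - i = - s\<close>, the squares add up to
    \<open>hr^2 * (s^2 + (K + 1 - i)) = hr^2 * (s^2 - s)\<close>.\<close>
  have "(\<Sum>l<Suc K. haar_entry K i l * haar_entry K i l) =
      (haar_hr K i)\<^sup>2 * ((haar_s K i)\<^sup>2 - haar_s K i)"
    using haar_row_sum[OF i assms, of "\<lambda>x. x * x"]
    by (simp add: haar_hd_def haar_s_def power2_eq_square algebra_simps)
  with haar_norm_factor[OF i assms] show ?thesis by simp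
qed

text \<open>Row \<open>i\<close> is constant on the support of row \<open>j\<close>, whose entries add up to zero.\<close>

lemma haar_rows_orthogonal_less:
  assumes "i < j" "j \<le> K"
  shows "(\<Sum>l<Suc K. haar_entry K i l * haar_entry K j l) = 0"
proof -
  \<comment> \<open>The support of row \<open>j\<close> starts at column \<open>j - 1\<close>, and
    \<open>j - 1 \<ge> i\<close>, so row \<open>i\<close> has already reached its final constant
    value there.\<close>
  define c where "c = (if i = 0 then 1 else haar_hr K i)"
  have j: "1 \<le> j" using assms by simp
  have "(\<Sum>l<Suc K. haar_entry K i l * haar_entry K j l) = (\<Sum>l<Suc K. c * haar_entry K j l)"
    by (rule sum.cong) (use assms in \<open>auto simp: haar_entry_def c_def\<close>)
  also have "\<dots> = 0"
    using haar_row_sum[OF j assms(2), of "\<lambda>x. c * x"]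
    by (simp add: haar_hd_def haar_s_def algebra_simps)
  finally show ?thesis .
qed

lemma haar_rows_orthogonal:
  assumes "i \<le> K" "j \<le> K"
  shows "(\<Sum>l<Suc K. haar_entry K i l * haar_entry K j l) = (if i = j then real K + 1 else 0)"
  using haar_row_norm[OF assms(1)] haar_rows_orthogonal_less[of i j K]
    haar_rows_orthogonal_less[of j i K] assms
  by (cases i j rule: linorder_cases) (auto simp: mult.commute)

lemma canonical_haar_orthogonal:
  "(canonical_haar :: 'n::{finite,linorder} rmat) ** transpose canonical_haar =
     real CARD('n) *\<^sub>R mat 1"
proof -
  have K: "CARD('n) = Suc (CARD('n) - 1)" by simp
  have le: "pos (i::'n) \<le> CARD('n) - 1" for i
    using pos_less_card[of i] by linarith
  have "(\<Sum>l\<in>(UNIV :: 'n set). haar_entry (CARD('n) - 1) (pos i) (pos l) *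
           haar_entry (CARD('n) - 1) (pos j) (pos l)) =
         (if i = j then real CARD('n) else 0)" for i j :: 'n
    using haar_rows_orthogonal[OF le le, of i j] K
    by (subst sum_pos[of "\<lambda>l. haar_entry (CARD('n) - 1) (pos i) l * haar_entry (CARD('n) - 1) (pos j) l"])
      (auto simp: inj_eq[OF inj_pos])
  then show ?thesis
    by (simp add: vec_eq_iff matrix_matrix_mult_def transpose_def canonical_haar_def mat_def)
qed

text \<open>\<open>Q\<close> cancels directly only in the first product; the second follows because
  a right inverse of a square matrix is also a left inverse.\<close>

lemma haar_type_orthogonal:
  assumes "haar_type (A :: 'n::{finite,linorder} rmat)"
  shows "A ** transpose A = real CARD('n) *\<^sub>R mat 1"
    and "transpose A ** A = real CARD('n) *\<^sub>R mat 1"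
proof -
  obtain Q where Q: "orthogonal_matrix Q" and A: "A = Q ** canonical_haar"
    using assms unfolding haar_type_def by blast
  have "A ** transpose A = Q ** (canonical_haar ** transpose canonical_haar) ** transpose Q"
    by (simp add: A matrix_transpose_mul matrix_mul_assoc)
  also have "\<dots> = real CARD('n) *\<^sub>R mat 1"
    using Q by (simp add: canonical_haar_orthogonal orthogonal_matrix_def matrix_scalar_ac
        scalar_matrix_assoc[symmetric])
  finally show *: "A ** transpose A = real CARD('n) *\<^sub>R mat 1" .
  then have "A ** ((1 / real CARD('n)) *\<^sub>R transpose A) = mat 1"
    by (simp add: matrix_scalar_ac scalar_matrix_assoc[symmetric])
  then have "((1 / real CARD('n)) *\<^sub>R transpose A) ** A = mat 1"
    by (simp add: matrix_left_right_inverse)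
  then have "(1 / real CARD('n)) *\<^sub>R (transpose A ** A) = mat 1"
    by (simp add: scalar_matrix_assoc)
  then show "transpose A ** A = real CARD('n) *\<^sub>R mat 1"
    by (metis (no_types, opaque_lifting) divide_eq_1_iff of_nat_eq_0_iff
        scaleR_one scaleR_scaleR times_divide_eq_right mult.right_neutral zero_less_card_finite less_irrefl)
qed

text \<open>\<open>Q\<close> acts as the identity on index 0, so the row of ones survives; this is
  what makes \<open>e1\<close> represent the constant 1.\<close>

lemma haar_type_row0:
  assumes "haar_type A" "pos k = 0"
  shows "A $ k $ l = 1"
proof -
  obtain Q where Q: "\<forall>i j. pos i = 0 \<or> pos j = 0 \<longrightarrow> Q $ i $ j = (if i = j then 1 else 0)"
    and A: "A = Q ** canonical_haar"
    using assms unfolding haar_type_def by blast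
  have "A $ k $ l = (\<Sum>j\<in>UNIV. (if k = j then 1 else 0) * canonical_haar $ j $ l)"
    unfolding A matrix_matrix_mult_def using Q assms(2) by simp
  also have "\<dots> = (\<Sum>j\<in>UNIV. if k = j then canonical_haar $ j $ l else 0)"
    by (rule sum.cong) auto
  also have "\<dots> = 1"
    using assms(2) by (simp add: canonical_haar_def haar_entry_def)
  finally show ?thesis .
qed

section \<open>Cells and integrals of step functions\<close>

abbreviation cell :: "'n::{finite,linorder} \<Rightarrow> real set" where
  "cell l \<equiv> {real (pos l) / real CARD('n) <..< (real (pos l) + 1) / real CARD('n)}"

definition cell_values :: "'n::{finite,linorder} rmat \<Rightarrow> 'n rvec \<Rightarrow> 'n rvec" where
  "cell_values A w = transpose A *v w"

text \<open>Polymorphic in the entries because it is used over the reals and, for characteristic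
  polynomials, over complex polynomials.\<close>

definition diagonal :: "'a::zero ^ 'n \<Rightarrow> 'a ^ 'n ^ 'n" where
  "diagonal c = (\<chi> i j. if i = j then c $ i else 0)"

lemma cell_subset: "cell (l :: 'n::{finite,linorder}) \<subseteq> {0..1}"
proof
  fix \<xi> assume \<xi>: "\<xi> \<in> cell l"
  have "real (pos l) + 1 \<le> real CARD('n)" using pos_less_card[of l] by linarith
  then have "(real (pos l) + 1) / real CARD('n) \<le> 1" "0 \<le> real (pos l) / real CARD('n)" by auto
  with \<xi> show "\<xi> \<in> {0..1}" unfolding atLeastAtMost_iff greaterThanLessThan_iff by linarith
qed

text \<open>Openness of the cell is essential: the closed unit intervals behind the basis functions
  overlap at the grid points, where two indicators equal 1.\<close>

lemma indicator_cell:
  fixes k l :: "'n::{finite,linorder}"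
  assumes "\<xi> \<in> cell l"
  shows "indicat_real {0..1} (real CARD('n) * \<xi> - real (pos k)) = (if k = l then 1 else 0)"
proof -
  have 1: "real (pos l) < real CARD('n) * \<xi>" "real CARD('n) * \<xi> < real (pos l) + 1"
    using assms by (auto simp: field_simps)
  show ?thesis
  proof (cases "k = l")
    case True
    then show ?thesis using 1 by (auto simp: indicator_def)
  next
    case False
    then have "pos k \<noteq> pos l" using inj_pos by (auto simp: inj_def)
    then have "real (pos k) \<le> real (pos l) - 1 \<or> real (pos k) \<ge> real (pos l) + 1" by linarith
    then show ?thesis using 1 False by (auto simp: indicator_def)
  qed
qed

lemma basis_fun_cell:
  assumes "\<xi> \<in> cell l"
  shows "basis_fun A k \<xi> = A $ k $ l"
proof -
  have "basis_fun A k \<xi> = (\<Sum>j\<in>UNIV. if j = l then A $ k $ j else 0)"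
    unfolding basis_fun_def by (rule sum.cong) (simp_all add: indicator_cell[OF assms])
  then show ?thesis by simp
qed

lemma basis_fun_outside:
  fixes A :: "'n::{finite,linorder} rmat"
  assumes "\<xi> \<notin> {0..1}"
  shows "basis_fun A k \<xi> = 0"
proof -
  have "indicat_real {0..1} (real CARD('n) * \<xi> - real (pos l)) = 0" for l :: 'n
  proof -
    have "real (pos l) + 1 \<le> real CARD('n)" using pos_less_card[of l] by linarith
    moreover have "real CARD('n) * \<xi> < 0 \<or> real CARD('n) * \<xi> > real CARD('n)"
      using assms by (auto simp: mult_less_0_iff)
    ultimately have "real CARD('n) * \<xi> - real (pos l) \<notin> {0..1}" unfolding atLeastAtMost_iff by linarith
    then show ?thesis by (rule indicator_simps(2))
  qed
  then show ?thesis unfolding basis_fun_def by simp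
qed

lemma expansion_cell:
  assumes "\<xi> \<in> cell l"
  shows "expansion A w \<xi> = cell_values A w $ l"
  unfolding expansion_def cell_values_def
  by (simp add: basis_fun_cell[OF assms] matrix_vector_mult_def transpose_def mult.commute)

lemma in_cell_or_grid:
  fixes \<xi> :: real
  assumes "\<xi> \<in> {0..1}"
  obtains (inside) l :: "'n::{finite,linorder}" where "\<xi> \<in> cell l"
  | (grid) m where "m \<le> CARD('n)" "\<xi> = real m / real CARD('n)"
proof -
  define y where "y = real CARD('n) * \<xi>"
  define m where "m = nat \<lfloor>y\<rfloor>"
  have y: "0 \<le> y" "y \<le> real CARD('n)" using assms by (auto simp: y_def mult_left_le)
  have m: "real m \<le> y" "y < real m + 1" using y unfolding m_def by linarith+
  show thesis
  proof (cases "y = real m")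
    case True
    then show thesis using y grid[of m] by (simp add: y_def field_simps)
  next
    case False
    then have "real m < y" "m < CARD('n)" using m y by linarith+
    then obtain l :: 'n where "pos l = m"
      using bij_pos[where 'n='n] by (metis bij_betw_iff_bijections lessThan_iff)
    then show thesis using m \<open>real m < y\<close> inside[of l] by (auto simp: y_def field_simps)
  qed
qed

lemma cells_disjoint:
  assumes "\<xi> \<in> cell k" "\<xi> \<in> cell l"
  shows "k = l"
  using indicator_cell[OF assms(1), of k] indicator_cell[OF assms(2), of k] by (auto split: if_splits)

text \<open>The values of \<open>g\<close> on the finitely many cell boundaries are arbitrary.\<close>

lemma integral_step:
  fixes g :: "real \<Rightarrow> real" and c :: "'n::{finite,linorder} \<Rightarrow> real"
  assumes cells: "\<And>l \<xi>. \<xi> \<in> cell l \<Longrightarrow> g \<xi> = c l"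
    and outside: "\<And>\<xi>. \<xi> \<notin> {0..1} \<Longrightarrow> g \<xi> = 0"
  shows "(\<integral>\<xi>. g \<xi> \<partial>unif01) = (\<Sum>l\<in>UNIV. c l) / real CARD('n)"
proof -
  define N where "N = real CARD('n)"
  have N: "N > 0" by (simp add: N_def)
  \<comment> \<open>All \<open>CARD('n) + 1\<close> cell boundaries, both endpoints of the unit
    interval included.\<close>
  define G where "G = (\<lambda>m. real m / N) ` {..CARD('n)}"
  define s where "s = (\<lambda>\<xi>. \<Sum>l\<in>(UNIV::'n set). c l * indicator (cell l) \<xi>)"
  have fin: "finite G" by (simp add: G_def)
  have s_cell: "s \<xi> = c l" if "\<xi> \<in> cell l" for \<xi> and l :: 'n
  proof -
    have ind: "indicat_real (cell k) \<xi> = (if k = l then 1 else 0)" for k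
    proof (cases "k = l")
      case True
      with that show ?thesis by (simp only: indicator_simps(1) if_True simp_thms)
    next
      case False
      with that have "\<xi> \<notin> cell k" using cells_disjoint by blast
      with False show ?thesis by (simp only: indicator_simps(2) if_False not_False_eq_True)
    qed
    have "s \<xi> = (\<Sum>k\<in>UNIV. if k = l then c k else 0)"
      unfolding s_def ind by (rule sum.cong) simp_all
    then show ?thesis by simp
  qed
  have s_eq: "g \<xi> = s \<xi>" if "\<xi> \<notin> G" for \<xi>
  proof (cases "\<xi> \<in> {0..1}")
    case True
    then show ?thesis
      by (cases rule: in_cell_or_grid[where 'n='n])
        (use that in \<open>auto simp: s_cell cells G_def N_def\<close>)
  next
    case False
    then have "\<xi> \<notin> cell l" for l :: 'n using cell_subset[of l] by blast
    then have "s \<xi> = 0" unfolding s_def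
      by (intro sum.neutral ballI) (simp only: indicator_simps(2) mult_zero_right not_False_eq_True)
    then show ?thesis using outside[OF False] by simp
  qed
  have s_int: "(\<integral>\<xi>. s \<xi> \<partial>lborel) = (\<Sum>l\<in>UNIV. c l) / N"
  proof -
    have m: "measure lborel (cell l) = 1 / N" for l :: 'n
      unfolding N_def[symmetric] using N by (simp add: field_simps divide_right_mono)
    have "integrable lborel (\<lambda>\<xi>. c l * indicator (cell l) \<xi>)" for l :: 'n
      by (intro integrable_mult_right integrable_real_indicator) (auto simp: emeasure_lborel_Ioo divide_right_mono)
    then have "(\<integral>\<xi>. s \<xi> \<partial>lborel) = (\<Sum>l\<in>UNIV. \<integral>\<xi>. c l * indicator (cell l) \<xi> \<partial>lborel)"
      unfolding s_def by (rule Bochner_Integration.integral_sum)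
    also have "\<dots> = (\<Sum>l\<in>UNIV. c l * (1 / N))"
    proof (rule sum.cong[OF refl])
      fix l :: 'n
      have "(\<integral>\<xi>. indicat_real (cell l) \<xi> \<partial>lborel) = measure lborel (cell l)"
        by (simp only: Bochner_Integration.integral_indicator space_lborel space_borel Int_UNIV_right)
      then show "(\<integral>\<xi>. c l * indicator (cell l) \<xi> \<partial>lborel) = c l * (1 / N)"
        by (simp only: integral_mult_right_zero m)
    qed
    finally show ?thesis by (simp add: sum_divide_distrib)
  qed
  have [measurable]: "s \<in> borel_measurable borel" unfolding s_def by measurable
  have [measurable]: "g \<in> borel_measurable borel"
  proof -
    \<comment> \<open>Agreement almost everywhere would not give Borel measurability of
      \<open>g\<close>. Here the exceptional set is finite, so \<open>g\<close> is the step function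
      plus a finite combination of indicators of points.\<close>
    have "g = (\<lambda>\<xi>. s \<xi> + (\<Sum>x\<in>G. (g x - s x) * indicator {x} \<xi>))"
    proof
      fix \<xi>
      have "(\<Sum>x\<in>G. (g x - s x) * indicator {x} \<xi>) = (\<Sum>x\<in>G. if x = \<xi> then g x - s x else 0)"
        by (rule sum.cong) (auto simp: indicator_def)
      also have "\<dots> = g \<xi> - s \<xi>" using fin s_eq by simp
      finally show "g \<xi> = s \<xi> + (\<Sum>x\<in>G. (g x - s x) * indicator {x} \<xi>)" by simp
    qed
    moreover have "(\<lambda>\<xi>. s \<xi> + (\<Sum>x\<in>G. (g x - s x) * indicator {x} \<xi>)) \<in> borel_measurable borel"
      by measurable
    ultimately show ?thesis by simp
  qed
  have "unif01 = density lborel (indicator {0..1})"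
    unfolding unif01_def uniform_measure_def by (rule arg_cong[of _ _ "density lborel"]) (auto simp: indicator_def)
  also have "\<dots> = density lborel (\<lambda>\<xi>. ennreal (indicator {0..1} \<xi>))"
    by (simp add: ennreal_indicator)
  finally have unif01: "unif01 = density lborel (\<lambda>\<xi>. ennreal (indicator {0..1} \<xi>))" .
  have "(\<integral>\<xi>. g \<xi> \<partial>unif01) = (\<integral>\<xi>. indicat_real {0..1} \<xi> *\<^sub>R g \<xi> \<partial>lborel)"
    unfolding unif01 by (rule integral_density) auto
  also have "\<dots> = (\<integral>\<xi>. s \<xi> \<partial>lborel)"
  proof (rule integral_cong_AE)
    have "AE \<xi> in lborel. \<xi> \<notin> G" using fin
      by (intro AE_not_in finite_imp_null_set_lborel)
    then show "AE \<xi> in lborel. indicat_real {0..1} \<xi> *\<^sub>R g \<xi> = s \<xi>"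
    proof eventually_elim
      case (elim \<xi>)
      then show ?case by (cases "\<xi> \<in> {0..1}") (simp_all only: s_eq[symmetric] outside indicator_simps scaleR_one scaleR_zero_right not_False_eq_True)
    qed
  qed auto
  finally show ?thesis by (simp add: s_int N_def)
qed

text \<open>A cell has positive measure, so no null set contains it. This turns almost sure
  hypotheses on the random state into statements about every single cell value.\<close>

lemma AE_unif01_cell:
  fixes l :: "'n::{finite,linorder}"
  assumes "AE \<xi> in unif01. P \<xi>"
  obtains \<xi> where "\<xi> \<in> cell l" "P \<xi>"
proof -
  have AE: "AE \<xi> in lborel. \<xi> \<in> {0..1} \<longrightarrow> P \<xi>"
    using assms unfolding unif01_def by (subst (asm) AE_uniform_measure) auto
  have *: "AE \<xi> in lborel. \<xi> \<in> cell l \<longrightarrow> P \<xi>"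
    by (rule eventually_mono[OF AE]) (use cell_subset[of l] in blast)
  show thesis
  proof (rule ccontr)
    assume "\<not> thesis"
    then have "\<forall>\<xi>\<in>cell l. \<not> P \<xi>" using that by blast
    then have "AE \<xi> in lborel. \<xi> \<notin> cell l" by (intro eventually_mono[OF *]) blast
    then have "cell l \<in> null_sets lborel"
      by (subst AE_iff_null_sets) simp_all
    then have "emeasure lborel (cell l) = 0" by (rule null_setsD1)
    moreover have "emeasure lborel (cell l) = ennreal (1 / real CARD('n))"
      by (subst emeasure_lborel_Ioo) (simp_all add: divide_right_mono add_divide_distrib)
    ultimately show False by simp
  qed
qed

section \<open>Galerkin calculus in terms of cell values\<close>

declare transpose_matrix_vector [simp del]

lemma diagonal_mult_nth: "(diagonal c ** M) $ i $ j = (c $ i * M $ i $ j :: 'a::semiring_1)"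
proof -
  have "(diagonal c ** M) $ i $ j = (\<Sum>k\<in>UNIV. if i = k then c $ i * M $ k $ j else 0)"
    unfolding matrix_matrix_mult_def diagonal_def vec_lambda_beta
    by (rule sum.cong) auto
  then show ?thesis by simp
qed

lemma mult_diagonal_nth: "(M ** diagonal c) $ i $ j = (M $ i $ j * c $ j :: 'a::semiring_1)"
proof -
  have "(M ** diagonal c) $ i $ j = (\<Sum>k\<in>UNIV. if k = j then M $ i $ k * c $ j else 0)"
    unfolding matrix_matrix_mult_def diagonal_def vec_lambda_beta
    by (rule sum.cong) auto
  then show ?thesis by simp
qed

lemma diagonal_vector_nth: "(diagonal c *v x) $ i = (c $ i * x $ i :: 'a::semiring_1)"
proof -
  have "(diagonal c *v x) $ i = (\<Sum>k\<in>UNIV. if i = k then c $ i * x $ k else 0)"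
    unfolding matrix_vector_mult_def diagonal_def vec_lambda_beta
    by (rule sum.cong) auto
  then show ?thesis by simp
qed

lemma diag_map_diagonal: "diag_map g (diagonal c) = diagonal (\<chi> l. g (c $ l))"
  by (simp add: diag_map_def diagonal_def vec_eq_iff)

text \<open>The basis function makes the integrand vanish outside the unit interval, which is the
  second premise of \<open>integral_step\<close>.\<close>

lemma modes_step:
  fixes A :: "'n::{finite,linorder} rmat"
  assumes "\<And>l \<xi>. \<xi> \<in> cell l \<Longrightarrow> g \<xi> = c $ l"
  shows "modes A g = (1 / real CARD('n)) *\<^sub>R (A *v c)"
proof -
  have "ip g (basis_fun A k) = (\<Sum>l\<in>UNIV. c $ l * A $ k $ l) / real CARD('n)" for k
    unfolding ip_def
    by (rule integral_step) (simp_all only: assms basis_fun_cell basis_fun_outside mult_zero_right simp_thms)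
  then show ?thesis
    by (simp add: modes_def vec_eq_iff matrix_vector_mult_def mult.commute)
qed

lemma triple_matrix_nth:
  fixes A :: "'n::{finite,linorder} rmat"
  shows "triple_matrix A k $ i $ j = (\<Sum>l\<in>UNIV. A $ k $ l * (A $ i $ l * A $ j $ l)) / real CARD('n)"
proof -
  have "ip (basis_fun A k) (\<lambda>\<xi>. basis_fun A i \<xi> * basis_fun A j \<xi>) =
      (\<Sum>l\<in>UNIV. A $ k $ l * (A $ i $ l * A $ j $ l)) / real CARD('n)"
    unfolding ip_def
    by (rule integral_step) (simp_all only: basis_fun_cell basis_fun_outside mult_zero_left simp_thms)
  then show ?thesis by (simp add: triple_matrix_def)
qed

text \<open>A triple product integrates to a sum over cells; summing over the modes first leaves in
  each cell just the cell value of \<open>w\<close>.\<close>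

lemma galerkin_matrix_eq:
  fixes A :: "'n::{finite,linorder} rmat"
  shows "galerkin_matrix A w =
    (1 / real CARD('n)) *\<^sub>R (A ** diagonal (cell_values A w) ** transpose A)"
proof -
  have "galerkin_matrix A w $ i $ j =
      ((1 / real CARD('n)) *\<^sub>R (A ** diagonal (cell_values A w) ** transpose A)) $ i $ j" for i j
  proof -
    have "galerkin_matrix A w $ i $ j = (\<Sum>k\<in>UNIV. w $ k * (\<Sum>l\<in>UNIV. A $ k $ l * (A $ i $ l * A $ j $ l))) / real CARD('n)"
      by (simp add: galerkin_matrix_def triple_matrix_nth flip: sum_divide_distrib)
    also have "(\<Sum>k\<in>UNIV. w $ k * (\<Sum>l\<in>UNIV. A $ k $ l * (A $ i $ l * A $ j $ l))) =
        (\<Sum>k\<in>UNIV. \<Sum>l\<in>UNIV. A $ i $ l * (A $ k $ l * w $ k) * A $ j $ l)"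
      by (simp add: sum_distrib_left mult_ac)
    also have "\<dots> = (\<Sum>l\<in>UNIV. \<Sum>k\<in>UNIV. A $ i $ l * (A $ k $ l * w $ k) * A $ j $ l)"
      by (rule sum.swap)
    also have "\<dots> = (\<Sum>l\<in>UNIV. (A ** diagonal (cell_values A w)) $ i $ l * A $ j $ l)"
      by (simp add: mult_diagonal_nth cell_values_def matrix_vector_mult_def transpose_def
          sum_distrib_left sum_distrib_right)
    also have "\<dots> = (A ** diagonal (cell_values A w) ** transpose A) $ i $ j"
      by (subst (2) matrix_matrix_mult_def) (simp add: transpose_def)
    finally show ?thesis by simp
  qed
  then show ?thesis by (simp add: vec_eq_iff)
qed

lemma cell_values_add: "cell_values A (v + w) = cell_values A v + cell_values A w"
  by (simp add: cell_values_def matrix_vector_right_distrib)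

lemma cell_values_diff: "cell_values A (v - w) = cell_values A v - cell_values A w"
  by (simp add: cell_values_def matrix_vector_mult_diff_distrib)

lemma cell_values_scaleR: "cell_values A (r *\<^sub>R w) = r *\<^sub>R cell_values A w"
  by (simp add: cell_values_def matrix_vector_mult_scaleR)

context
  fixes A :: "'n::{finite,linorder} rmat"
  assumes haar: "haar_type A"
begin

lemma cell_values_mult: "cell_values A (A *v c) = real CARD('n) *\<^sub>R c"
  by (simp add: cell_values_def matrix_vector_mul_assoc haar_type_orthogonal[OF haar]
      scaleR_matrix_vector_assoc[symmetric])

lemma mult_cell_values: "A *v cell_values A w = real CARD('n) *\<^sub>R w"
  by (simp add: cell_values_def matrix_vector_mul_assoc haar_type_orthogonal[OF haar]
      scaleR_matrix_vector_assoc[symmetric])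

lemma cell_values_inject: "cell_values A v = cell_values A w \<longleftrightarrow> v = w"
proof
  assume "cell_values A v = cell_values A w"
  then have "real CARD('n) *\<^sub>R v = real CARD('n) *\<^sub>R w"
    by (metis mult_cell_values)
  then show "v = w" by simp
qed simp

lemma eig_matrix_eq: "eig_matrix A w = diagonal (cell_values A w)"
proof -
  define N where "N = real CARD('n)"
  have N: "N > 0" by (simp add: N_def)
  define D where "D = diagonal (cell_values A w)"
  \<comment> \<open>Each \<open>scaled_haar A\<close> contributes \<open>1 / sqrt N\<close> and the
    Galerkin matrix \<open>1 / N\<close>; the two products \<open>transpose A ** A\<close>
    compensate with \<open>N * N\<close>.\<close>
  have "eig_matrix A w = (1 / sqrt N * (1 / sqrt N) * (1 / N)) *\<^sub>R
      (transpose A ** (A ** D ** transpose A) ** A)"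
    unfolding eig_matrix_def scaled_haar_def galerkin_matrix_eq N_def[symmetric] D_def[symmetric]
    by (simp add: transpose_scalar matrix_scalar_ac scalar_matrix_assoc[symmetric] mult_ac)
  also have "transpose A ** (A ** D ** transpose A) ** A = (transpose A ** A) ** D ** (transpose A ** A)"
    by (simp add: matrix_mul_assoc)
  also have "\<dots> = (N * N) *\<^sub>R D"
    by (simp add: haar_type_orthogonal[OF haar] N_def matrix_scalar_ac scalar_matrix_assoc[symmetric])
  finally show ?thesis using N by (simp add: D_def)
qed

lemma eig_matrix_nth: "eig_matrix A w $ i $ i = cell_values A w $ i"
  by (simp add: eig_matrix_eq diagonal_def)

text \<open>Row 0 consists of ones, so \<open>e1\<close> holds the modes of the constant function
  1.\<close>

lemma cell_values_e1: "cell_values A e1 = 1"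
proof -
  have "cell_values A e1 $ l = 1" for l
  proof -
    obtain z :: 'n where z: "pos z = 0"
      using bij_pos[where 'n='n] by (metis bij_betw_iff_bijections lessThan_iff zero_less_card_finite)
    have "pos k = 0 \<longleftrightarrow> k = z" for k using inj_pos z by (metis injD)
    then have "cell_values A e1 $ l = (\<Sum>k\<in>UNIV. if k = z then A $ k $ l else 0)"
      unfolding cell_values_def matrix_vector_mult_def transpose_def e1_def vec_lambda_beta
      by (intro sum.cong) auto
    then show ?thesis using haar_type_row0[OF haar z] by simp
  qed
  then show ?thesis by (simp add: vec_eq_iff)
qed

lemma cell_values_galerkin_prod: "cell_values A (galerkin_prod A w q) = cell_values A w * cell_values A q"
  by (simp add: galerkin_prod_def galerkin_matrix_eq scaleR_matrix_vector_assoc[symmetric]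
      matrix_vector_mul_assoc[symmetric] cell_values_scaleR cell_values_mult)
    (simp add: vec_eq_iff diagonal_vector_nth cell_values_def)

text \<open>Applying the conjugated matrix to \<open>e1\<close> means letting
  \<open>diagonal c\<close> act on the constant 1, which reads off its diagonal as cell
  values.\<close>

lemma cell_values_diag_modes:
  "cell_values A (diag_modes A (diagonal c)) = c"
proof -
  have "diag_modes A (diagonal c) = (1 / real CARD('n)) *\<^sub>R (A *v (diagonal c *v cell_values A e1))"
    unfolding diag_modes_def scaled_haar_def cell_values_def
    by (simp add: transpose_scalar matrix_scalar_ac scalar_matrix_assoc[symmetric]
        matrix_mul_assoc matrix_vector_mul_assoc scaleR_matrix_vector_assoc[symmetric])
  moreover have "diagonal c *v 1 = c" by (simp add: vec_eq_iff diagonal_vector_nth)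
  ultimately show ?thesis
    by (simp add: cell_values_scaleR cell_values_mult cell_values_e1)
qed

lemma cell_values_sign_modes: "cell_values A (sign_modes A w) = (\<chi> l. sgn (cell_values A w $ l))"
  by (simp add: sign_modes_def eig_matrix_eq diag_map_diagonal cell_values_diag_modes)

lemma cell_values_power_modes:
  "cell_values A (power_modes A a w) = (\<chi> l. cell_values A w $ l powr a)"
  by (simp add: power_modes_def eig_matrix_eq diag_map_diagonal cell_values_diag_modes)

lemma cell_values_modes:
  assumes "\<And>l \<xi>. \<xi> \<in> cell l \<Longrightarrow> g \<xi> = c $ l"
  shows "cell_values A (modes A g) = c"
proof -
  have "modes A g = (1 / real CARD('n)) *\<^sub>R (A *v c)" by (rule modes_step) (rule assms)
  then show ?thesis by (simp add: cell_values_scaleR cell_values_mult)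
qed

lemma modes_expansion: "modes A (expansion A w) = w"
proof -
  have "cell_values A (modes A (expansion A w)) = cell_values A w"
    by (rule cell_values_modes) (rule expansion_cell)
  then show ?thesis by (simp only: cell_values_inject)
qed

text \<open>The test vector \<open>A *v axis l 1\<close> is concentrated in cell \<open>l\<close>,
  so the quadratic form reduces to a positive multiple of that cell value.\<close>

lemma Hplus_cell_values_pos:
  assumes "w \<in> Hplus A"
  shows "cell_values A w $ l > 0"
proof -
  define x where "x = A *v axis l 1"
  have tx: "transpose A *v x = real CARD('n) *\<^sub>R axis l 1"
    using cell_values_mult[of "axis l 1"] by (simp add: x_def cell_values_def)
  then have "x \<noteq> 0" by (auto simp: axis_eq_0_iff)
  then have "0 < x \<bullet> (galerkin_matrix A w *v x)"
    using assms by (simp add: Hplus_def strictly_pos_def_def)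
  also have "galerkin_matrix A w *v x = A *v (diagonal (cell_values A w) *v axis l 1)"
    by (simp add: galerkin_matrix_eq scaleR_matrix_vector_assoc[symmetric]
        matrix_vector_mul_assoc[symmetric] tx matrix_vector_mult_scaleR)
  also have "x \<bullet> \<dots> = (transpose A *v x) \<bullet> (diagonal (cell_values A w) *v axis l 1)"
    by (simp add: dot_lmul_matrix transpose_matrix_vector)
  also have "\<dots> = real CARD('n) * cell_values A w $ l"
    by (simp add: tx inner_axis' diagonal_vector_nth)
  finally show ?thesis by (simp add: zero_less_mult_iff)
qed

end

section \<open>Block matrices and their characteristic polynomials\<close>

lemma sum_Plus_UNIV:
  fixes f :: "'a::finite + 'b::finite \<Rightarrow> 'c::comm_monoid_add"
  shows "(\<Sum>i\<in>UNIV. f i) = (\<Sum>a\<in>UNIV. f (Inl a)) + (\<Sum>b\<in>UNIV. f (Inr b))"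
  unfolding UNIV_Plus_UNIV[symmetric] by (subst sum.Plus) (simp_all add: o_def)

lemma prod_Plus_UNIV:
  fixes f :: "'a::finite + 'b::finite \<Rightarrow> 'c::comm_monoid_mult"
  shows "(\<Prod>i\<in>UNIV. f i) = (\<Prod>a\<in>UNIV. f (Inl a)) * (\<Prod>b\<in>UNIV. f (Inr b))"
  unfolding UNIV_Plus_UNIV[symmetric] by (subst prod.Plus) (simp_all add: o_def)

definition block :: "'a ^ 'n ^ 'n \<Rightarrow> 'a ^ 'n ^ 'n \<Rightarrow> 'a ^ 'n ^ 'n \<Rightarrow> 'a ^ 'n ^ 'n \<Rightarrow> 'a ^ ('n + 'n) ^ ('n + 'n)" where
  "block P Q R S = (\<chi> i j. case i of
     Inl a \<Rightarrow> (case j of Inl b \<Rightarrow> P $ a $ b | Inr b \<Rightarrow> Q $ a $ b)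
   | Inr a \<Rightarrow> (case j of Inl b \<Rightarrow> R $ a $ b | Inr b \<Rightarrow> S $ a $ b))"

lemma block_nth [simp]:
  "block P Q R S $ Inl a $ Inl b = P $ a $ b"
  "block P Q R S $ Inl a $ Inr b = Q $ a $ b"
  "block P Q R S $ Inr a $ Inl b = R $ a $ b"
  "block P Q R S $ Inr a $ Inr b = S $ a $ b"
  by (simp_all add: block_def)

lemma vec_plus_eq_iff: "v = (w :: 'a ^ ('n::finite + 'n)) \<longleftrightarrow> (\<forall>a. v $ Inl a = w $ Inl a) \<and> (\<forall>b. v $ Inr b = w $ Inr b)"
  by (metis vec_eq_iff sum.exhaust)

lemma block_mult:
  "block P Q R S ** block P' Q' R' S' =
     block (P ** P' + Q ** R') (P ** Q' + Q ** S') (R ** P' + S ** R') (R ** Q' + S ** S')"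
  by (simp add: vec_plus_eq_iff matrix_matrix_mult_def sum_Plus_UNIV)

lemma stack_nth [simp]: "stack u v $ Inl a = u $ a" "stack u v $ Inr a = v $ a"
  by (simp_all add: stack_def)

lemma ublock_nth [simp]: "ublock w $ a = w $ Inl a"
  and vblock_nth [simp]: "vblock w $ a = w $ Inr a"
  by (simp_all add: ublock_def vblock_def)

lemma block_vector:
  "block P Q R S *v w = stack (P *v ublock w + Q *v vblock w) (R *v ublock w + S *v vblock w)"
  by (simp add: vec_plus_eq_iff matrix_vector_mult_def sum_Plus_UNIV)

lemma mat_block: "mat c = block (mat c) 0 0 (mat c)"
  by (simp add: vec_plus_eq_iff mat_def)

lemma mat_eq_diagonal: "mat c = diagonal (\<chi> i. c)"
  by (simp add: mat_def diagonal_def vec_eq_iff)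

lemma minus_diagonal: "- diagonal c = diagonal (- c :: 'a::group_add ^ 'n)"
  by (simp add: diagonal_def vec_eq_iff)

lemma transpose_diagonal: "transpose (diagonal c) = diagonal c"
  by (simp add: transpose_def diagonal_def vec_eq_iff)

text \<open>A left index sent to the right would collide with a right index, all of which are fixed.
  Hence the Leibniz formula for a block triangular matrix with diagonal blocks has only one nonzero
  term.\<close>

lemma permutes_UNIV_block_triangular:
  fixes p :: "'n::finite + 'n \<Rightarrow> 'n + 'n"
  assumes p: "p permutes UNIV"
    and Inr: "\<And>b. p (Inr b) = Inr b" and Inl: "\<And>a a'. p (Inl a) = Inl a' \<Longrightarrow> a' = a"
  shows "p = id"
proof
  fix i
  show "p i = id i"
  proof (cases i)
    case (Inl a)
    show ?thesis
    proof (cases "p i")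
      case (Inl a')
      with \<open>i = Inl a\<close> assms(3) show ?thesis by auto
    next
      case (Inr b)
      then have "p i = p (Inr b)" using assms(2) by simp
      then have "i = Inr b" using permutes_inj[OF p] by (simp add: inj_eq)
      with \<open>i = Inl a\<close> show ?thesis by simp
    qed
  qed (simp add: assms(2))
qed

lemma det_block_upper:
  fixes p s :: "'a::comm_ring_1 ^ 'n"
  shows "det (block (diagonal p) Q 0 (diagonal s)) = (\<Prod>i\<in>UNIV. p $ i) * (\<Prod>i\<in>UNIV. s $ i)"
proof -
  let ?M = "block (diagonal p) Q 0 (diagonal s)"
  have "(\<Prod>i\<in>UNIV. ?M $ i $ q i) = 0" if q: "q permutes UNIV" "q \<noteq> id" for q
  proof (rule ccontr)
    assume "(\<Prod>i\<in>UNIV. ?M $ i $ q i) \<noteq> 0"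
    then have nz: "?M $ i $ q i \<noteq> 0" for i
      by (metis prod_zero finite UNIV_I)
    have "q (Inr b) = Inr b" for b
      using nz[of "Inr b"] by (cases "q (Inr b)") (auto simp: diagonal_def split: if_splits)
    moreover have "a' = a" if "q (Inl a) = Inl a'" for a a'
      using nz[of "Inl a"] that by (auto simp: diagonal_def split: if_splits)
    ultimately show False using permutes_UNIV_block_triangular[OF q(1)] q(2) by blast
  qed
  then have "det ?M = (\<Sum>q\<in>{id}. of_int (sign q) * (\<Prod>i\<in>UNIV. ?M $ i $ q i))"
    unfolding det_def
    by (intro sum.mono_neutral_right) (auto simp: finite_permutations permutes_id)
  then show ?thesis by (simp add: sign_id prod_Plus_UNIV diagonal_def)
qed

lemma transpose_block: "transpose (block P Q R S) = block (transpose P) (transpose R) (transpose Q) (transpose S)"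
  by (simp add: vec_plus_eq_iff transpose_def)

lemma det_block_lower:
  fixes p s :: "'a::comm_ring_1 ^ 'n"
  shows "det (block (diagonal p) 0 R (diagonal s)) = (\<Prod>i\<in>UNIV. p $ i) * (\<Prod>i\<in>UNIV. s $ i)"
proof -
  have "transpose (0 :: 'a ^ 'n ^ 'n) = 0" by (simp add: transpose_def vec_eq_iff)
  then have "transpose (block (diagonal p) 0 R (diagonal s)) = block (diagonal p) (transpose R) 0 (diagonal s)"
    by (simp add: transpose_block transpose_diagonal)
  then show ?thesis by (metis det_transpose det_block_upper)
qed

definition const_poly_matrix :: "real ^ 'm ^ 'm \<Rightarrow> complex poly ^ 'm ^ 'm" where
  "const_poly_matrix J = (\<chi> i j. [:complex_of_real (J $ i $ j):])"

lemma const_poly_sum: fixes f :: "'a \<Rightarrow> real" shows "[:complex_of_real (\<Sum>k\<in>K. f k):] = (\<Sum>k\<in>K. [:complex_of_real (f k):])"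
  by (rule poly_eqI) (simp add: coeff_sum coeff_pCons split: nat.split)

lemma const_poly_matrix_mult:
  "const_poly_matrix (M ** J) = const_poly_matrix M ** const_poly_matrix J"
proof -
  have "[:complex_of_real (a * b):] = [:complex_of_real a:] * [:complex_of_real b:]" for a b
    by simp
  then show ?thesis
    by (simp only: const_poly_matrix_def matrix_matrix_mult_def vec_eq_iff vec_lambda_beta const_poly_sum)
      simp
qed

lemma const_poly_matrix_mat_1: "const_poly_matrix (mat 1) = mat 1"
  by (simp add: const_poly_matrix_def mat_def vec_eq_iff one_pCons)

text \<open>\<open>?x\<close> is a scalar matrix and commutes with \<open>?S\<close>, so
  \<open>?x - S J R\<close> factors through \<open>?x - ?J\<close>; over the polynomial ring
  \<open>?S\<close> and \<open>?R\<close> remain inverse, and their determinants multiply to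
  1.\<close>

lemma char_poly_of_similar:
  fixes S R J :: "real ^ 'm ^ 'm"
  assumes "S ** R = mat 1"
  shows "char_poly_of (S ** J ** R) = char_poly_of J"
proof -
  let ?S = "const_poly_matrix S" and ?R = "const_poly_matrix R" and ?J = "const_poly_matrix J"
  let ?x = "mat [:0, 1:] :: complex poly ^ 'm ^ 'm"
  have SR: "?S ** ?R = mat 1"
    by (metis assms const_poly_matrix_mult const_poly_matrix_mat_1)
  have comm: "?S ** ?x = ?x ** ?S"
    by (simp add: vec_eq_iff mat_eq_diagonal diagonal_mult_nth mult_diagonal_nth mult.commute)
  have "?S ** (?x - ?J) ** ?R = ?S ** ?x ** ?R - ?S ** ?J ** ?R"
    by (simp add: matrix_matrix_mult_def vec_eq_iff left_diff_distrib right_diff_distrib sum_subtractf)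
  also have "?S ** ?x ** ?R = ?x"
    by (simp add: comm matrix_mul_assoc[symmetric] SR)
  finally have "?x - const_poly_matrix (S ** J ** R) = ?S ** (?x - ?J) ** ?R"
    by (simp add: const_poly_matrix_mult)
  then have "char_poly_of (S ** J ** R) = det ?S * det (?x - ?J) * det ?R"
    by (simp add: char_poly_of_def const_poly_matrix_def[symmetric] det_mul)
  also have "\<dots> = det (?S ** ?R) * det (?x - ?J)" by (simp add: det_mul)
  also have "\<dots> = char_poly_of J"
    unfolding SR by (simp add: char_poly_of_def const_poly_matrix_def)
  finally show ?thesis .
qed

text \<open>Multiplying from the right by a lower triangular matrix with determinant \<open>x ^ n\<close> makes the
  matrix \<open>x - J\<close> upper triangular.\<close>

lemma char_poly_of_wave_diagonal:
  fixes c :: "real ^ 'n"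
  shows "char_poly_of (block 0 (diagonal c) (- mat 1) 0) = (\<Prod>i\<in>UNIV. [:complex_of_real (c $ i), 0, 1:])"
proof -
  define x :: "complex poly" where "x = [:0, 1:]"
  define k where "k = (\<chi> i. [:complex_of_real (c $ i):])"
  let ?M = "block (mat x) (- diagonal k) (mat 1) (mat x)"
  \<comment> \<open>Chosen so that the lower left block of \<open>?M ** ?T\<close> is
    \<open>x - x\<close>. The surplus factor \<open>x ^ ?n\<close> can be cancelled because complex
    polynomials form an integral domain.\<close>
  let ?T = "block (mat x :: complex poly ^ 'n ^ 'n) 0 (- mat 1) (mat 1)"
  let ?n = "CARD('n)"
  have M: "char_poly_of (block 0 (diagonal c) (- mat 1) 0) = det ?M"
    unfolding char_poly_of_def
    by (rule arg_cong[of _ _ det]) (auto simp: vec_plus_eq_iff mat_def diagonal_def k_def x_def one_pCons)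
  have "?M ** ?T = block (diagonal (\<chi> i. x * x + k $ i)) (- diagonal k) 0 (diagonal (\<chi> i. x))"
    unfolding block_mult
    by (simp add: vec_plus_eq_iff mat_eq_diagonal minus_diagonal diagonal_mult_nth)
      (simp add: diagonal_def)
  then have "det (?M ** ?T) = (\<Prod>i\<in>UNIV. x * x + k $ i) * x ^ ?n"
    by (simp only: det_block_upper) simp
  then have "det ?M * det ?T = (\<Prod>i\<in>UNIV. x * x + k $ i) * x ^ ?n"
    by (simp only: det_mul)
  moreover have "det ?T = x ^ ?n"
    by (simp add: mat_eq_diagonal det_block_lower)
  moreover have "x \<noteq> 0" by (simp add: x_def)
  ultimately have "det ?M = (\<Prod>i\<in>UNIV. x * x + k $ i)" by simp
  then show ?thesis by (simp add: M x_def k_def)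
qed

text \<open>Conjugation with the doubled \<open>S\<close> preserves the scalar block
  \<open>- mat 1\<close>, and each factor is \<open>x^2 - m^2 = (x - m) * (x + m)\<close>. Both
  roots occur, so a negative \<open>m\<close> gives the same pair.\<close>

lemma spectrum_of_wave:
  fixes c m :: "real ^ 'n" and S R :: "real ^ 'n ^ 'n"
  assumes SR: "S ** R = mat 1" and c: "\<And>i. c $ i = - (m $ i)\<^sup>2"
  shows "spectrum_of (block 0 (S ** diagonal c ** R) (- mat 1) 0) =
    (\<Sum>i\<in>UNIV. {# complex_of_real (m $ i), - complex_of_real (m $ i) #})"
proof -
  have "block S 0 0 S ** block R 0 0 R = mat 1"
    by (simp add: block_mult SR mat_block[symmetric])
  moreover have "block S 0 0 S ** block 0 (diagonal c) (- mat 1) 0 ** block R 0 0 R =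
      block 0 (S ** diagonal c ** R) (- mat 1) 0"
  proof -
    have "S ** (- mat 1) ** R = - mat 1"
      using SR by (simp add: vec_eq_iff matrix_matrix_mult_def mat_def sum_negf if_distrib cong: if_cong)
    then show ?thesis by (simp add: block_mult)
  qed
  ultimately have "char_poly_of (block 0 (S ** diagonal c ** R) (- mat 1) 0) =
      (\<Prod>i\<in>UNIV. [:complex_of_real (c $ i), 0, 1:])"
    by (metis char_poly_of_similar char_poly_of_wave_diagonal)
  also have "\<dots> = (\<Prod>i\<in>UNIV. [:- complex_of_real (m $ i), 1:] * [:complex_of_real (m $ i), 1:])"
    by (simp add: c power2_eq_square)
  finally have eq: "spectrum_of (block 0 (S ** diagonal c ** R) (- mat 1) 0) =
      proots (\<Prod>i\<in>UNIV. [:- complex_of_real (m $ i), 1:] * [:complex_of_real (m $ i), 1:])"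
    by (simp only: spectrum_of_def)
  have "proots ([:- z, 1:] * [:z, 1:]) = {# z, - z #}" for z :: complex
    by (subst proots_mult) simp_all
  moreover have "[:- z, 1:] * [:z, 1:] \<noteq> 0" for z :: complex by simp
  ultimately show ?thesis unfolding eq
    by (subst proots_prod) (simp_all only: simp_thms)
qed

section \<open>Slopes and speeds of the scalar pressure law\<close>

definition power_slope :: "real \<Rightarrow> real \<Rightarrow> real" where
  "power_slope \<gamma> y = - \<gamma> * y powr (- \<gamma> - 1)"

lemma DERIV_power: "0 < y \<Longrightarrow> ((\<lambda>y. y powr (- \<gamma>)) has_real_derivative power_slope \<gamma> y) (at y)"
  unfolding power_slope_def by (rule has_real_derivative_powr)

lemma tendsto_power_slope:
  assumes "(f \<longlongrightarrow> y) F" "0 < y"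
  shows "((\<lambda>x. power_slope \<gamma> (f x)) \<longlongrightarrow> power_slope \<gamma> y) F"
  unfolding power_slope_def using assms by (intro tendsto_intros) auto

text \<open>The sign selects one branch off the kink. At \<open>y = b\<close> it is 0 and yields the
  mean of the two branches, which the jump constant makes equal.\<close>

lemma sign_switch_eq_pressure:
  "- (1 / 2) * ((sgn (y - b) - 1) * y powr (- \<gamma>\<^sub>1)) +
     1 / 2 * ((sgn (y - b) + 1) * (y powr (- \<gamma>\<^sub>2) + pressure_jump \<gamma>\<^sub>1 \<gamma>\<^sub>2 b)) = pressure \<gamma>\<^sub>1 \<gamma>\<^sub>2 b y"
  by (cases y b rule: linorder_cases) (auto simp: pressure_def pressure_jump_def field_simps)

lemma DERIV_pressure_below:
  assumes "0 < y" "y < b"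
  shows "(pressure \<gamma>\<^sub>1 \<gamma>\<^sub>2 b has_real_derivative power_slope \<gamma>\<^sub>1 y) (at y)"
  by (rule has_field_derivative_transform_within_open[OF DERIV_power[OF assms(1)], of "{..<b}"])
    (use assms in \<open>auto simp: pressure_def\<close>)

lemma DERIV_pressure_above:
  assumes "0 < y" "b < y"
  shows "(pressure \<gamma>\<^sub>1 \<gamma>\<^sub>2 b has_real_derivative power_slope \<gamma>\<^sub>2 y) (at y)"
proof -
  have "((\<lambda>y. y powr (- \<gamma>\<^sub>2) + pressure_jump \<gamma>\<^sub>1 \<gamma>\<^sub>2 b) has_real_derivative power_slope \<gamma>\<^sub>2 y) (at y)"
    using DERIV_add[OF DERIV_power[OF assms(1)] DERIV_const] by simp
  then show ?thesis
    by (rule has_field_derivative_transform_within_open[of _ _ _ "{b<..}"])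
      (use assms in \<open>auto simp: pressure_def\<close>)
qed

lemma DERIV_pressure_left:
  assumes "0 < b"
  shows "(pressure \<gamma>\<^sub>1 \<gamma>\<^sub>2 b has_real_derivative power_slope \<gamma>\<^sub>1 b) (at_left b)"
proof -
  have "eventually (\<lambda>y. pressure \<gamma>\<^sub>1 \<gamma>\<^sub>2 b y = y powr (- \<gamma>\<^sub>1)) (at_left b)"
    unfolding eventually_at_filter by (simp add: pressure_def)
  moreover have "pressure \<gamma>\<^sub>1 \<gamma>\<^sub>2 b b = b powr (- \<gamma>\<^sub>1)"
    by (simp add: pressure_def pressure_jump_def)
  ultimately show ?thesis
    using has_field_derivative_at_within[OF DERIV_power[OF assms]]
    by (rule has_field_derivative_cong_eventually[THEN iffD2])
qed

lemma DERIV_pressure_right: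
  assumes "0 < b"
  shows "(pressure \<gamma>\<^sub>1 \<gamma>\<^sub>2 b has_real_derivative power_slope \<gamma>\<^sub>2 b) (at_right b)"
proof -
  have "eventually (\<lambda>y. pressure \<gamma>\<^sub>1 \<gamma>\<^sub>2 b y = y powr (- \<gamma>\<^sub>2) + pressure_jump \<gamma>\<^sub>1 \<gamma>\<^sub>2 b) (at_right b)"
    unfolding eventually_at_filter by (simp add: pressure_def)
  moreover have "pressure \<gamma>\<^sub>1 \<gamma>\<^sub>2 b b = b powr (- \<gamma>\<^sub>2) + pressure_jump \<gamma>\<^sub>1 \<gamma>\<^sub>2 b"
    by (simp add: pressure_def)
  moreover have "((\<lambda>y. y powr (- \<gamma>\<^sub>2) + pressure_jump \<gamma>\<^sub>1 \<gamma>\<^sub>2 b) has_real_derivative power_slope \<gamma>\<^sub>2 b) (at_right b)"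
    by (rule has_field_derivative_at_within)
      (use DERIV_add[OF DERIV_power[OF assms] DERIV_const] in simp)
  ultimately show ?thesis by (rule has_field_derivative_cong_eventually[THEN iffD2])
qed

lemma has_real_derivative_unique_within:
  fixes f :: "real \<Rightarrow> real"
  assumes "(f has_real_derivative p) (at x within S)" "(f has_real_derivative q) (at x within S)"
    and "at x within S \<noteq> bot"
  shows "p = q"
  using assms tendsto_unique unfolding has_field_derivative_iff by blast

text \<open>Since \<open>power_slope \<gamma>\<close> has the sign of \<open>- \<gamma>\<close>, one
  point on each side of the kink, \<open>b / 2\<close> and \<open>2 * b\<close>, reveals that the
  exponents are positive. The kink condition follows from uniqueness of one-sided
  derivatives.\<close>

lemma admissible_pressureD:
  assumes "admissible_pressure \<gamma>\<^sub>1 \<gamma>\<^sub>2 b" "0 < b"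
  shows "0 < \<gamma>\<^sub>1" "0 < \<gamma>\<^sub>2" "power_slope \<gamma>\<^sub>1 b < power_slope \<gamma>\<^sub>2 b"
proof -
  have neg: "deriv (pressure \<gamma>\<^sub>1 \<gamma>\<^sub>2 b) v < 0" if "0 < v" "v \<noteq> b" for v
    using assms(1) that unfolding admissible_pressure_def by blast
  have "deriv (pressure \<gamma>\<^sub>1 \<gamma>\<^sub>2 b) (b / 2) = power_slope \<gamma>\<^sub>1 (b / 2)"
    using assms(2) by (intro DERIV_imp_deriv DERIV_pressure_below) auto
  then show "0 < \<gamma>\<^sub>1" using neg[of "b / 2"] assms(2)
    by (simp add: power_slope_def zero_less_mult_iff)
  have "deriv (pressure \<gamma>\<^sub>1 \<gamma>\<^sub>2 b) (2 * b) = power_slope \<gamma>\<^sub>2 (2 * b)"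
    using assms(2) by (intro DERIV_imp_deriv DERIV_pressure_above) auto
  then show "0 < \<gamma>\<^sub>2" using neg[of "2 * b"] assms(2)
    by (simp add: power_slope_def zero_less_mult_iff)
  obtain p q where "(pressure \<gamma>\<^sub>1 \<gamma>\<^sub>2 b has_real_derivative p) (at_left b)"
    "(pressure \<gamma>\<^sub>1 \<gamma>\<^sub>2 b has_real_derivative q) (at_right b)" "p < q"
    using assms(1) unfolding admissible_pressure_def by blast
  moreover from calculation have "p = power_slope \<gamma>\<^sub>1 b"
    by (intro has_real_derivative_unique_within[OF _ DERIV_pressure_left[OF assms(2)]]) simp_all
  moreover from calculation have "q = power_slope \<gamma>\<^sub>2 b"
    by (intro has_real_derivative_unique_within[OF _ DERIV_pressure_right[OF assms(2)]]) simp_all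
  ultimately show "power_slope \<gamma>\<^sub>1 b < power_slope \<gamma>\<^sub>2 b" by simp
qed

text \<open>A derivative would equal both one-sided derivatives. This keeps the sequences in
  Clarke's definition away from kinks.\<close>

lemma pressure_not_differentiable:
  assumes "0 < b" "power_slope \<gamma>\<^sub>1 b \<noteq> power_slope \<gamma>\<^sub>2 b"
  shows "\<not> pressure \<gamma>\<^sub>1 \<gamma>\<^sub>2 b differentiable (at b)"
proof
  assume "pressure \<gamma>\<^sub>1 \<gamma>\<^sub>2 b differentiable (at b)"
  then obtain p where p: "(pressure \<gamma>\<^sub>1 \<gamma>\<^sub>2 b has_real_derivative p) (at b)"
    by (meson real_differentiable_def)
  have "p = power_slope \<gamma>\<^sub>1 b"
    by (rule has_real_derivative_unique_within[OF has_field_derivative_at_within[OF p]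
          DERIV_pressure_left[OF assms(1)]]) simp
  moreover have "p = power_slope \<gamma>\<^sub>2 b"
    by (rule has_real_derivative_unique_within[OF has_field_derivative_at_within[OF p]
          DERIV_pressure_right[OF assms(1)]]) simp
  ultimately show False using assms(2) by simp
qed

text \<open>A diagonal entry of \<open>Dp_half\<close> when the sign has cell value
  \<open>\<sigma>\<close>. For positive \<open>y\<close> and exponents and \<open>\<sigma>\<close>
  between -1 and 1 it is negative, so it is minus the usual wave speed.\<close>

definition characteristic_speed :: "real \<Rightarrow> real \<Rightarrow> real \<Rightarrow> real \<Rightarrow> real" where
  "characteristic_speed \<gamma>\<^sub>1 \<gamma>\<^sub>2 \<sigma> y =
     sqrt \<gamma>\<^sub>1 / 2 * ((\<sigma> - 1) * y powr (- (\<gamma>\<^sub>1 + 1) / 2)) -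
     sqrt \<gamma>\<^sub>2 / 2 * ((\<sigma> + 1) * y powr (- (\<gamma>\<^sub>2 + 1) / 2))"

text \<open>Differs from \<open>slope_max\<close> only at \<open>y = b\<close>, where it takes the
  left slope; that this is the smaller one is exactly the kink condition.\<close>

definition slope_min :: "real \<Rightarrow> real \<Rightarrow> real \<Rightarrow> real \<Rightarrow> real" where
  "slope_min \<gamma>\<^sub>1 \<gamma>\<^sub>2 b y = (if y \<le> b then power_slope \<gamma>\<^sub>1 y else power_slope \<gamma>\<^sub>2 y)"

definition slope_max :: "real \<Rightarrow> real \<Rightarrow> real \<Rightarrow> real \<Rightarrow> real" where
  "slope_max \<gamma>\<^sub>1 \<gamma>\<^sub>2 b y = (if y < b then power_slope \<gamma>\<^sub>1 y else power_slope \<gamma>\<^sub>2 y)"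

lemma DERIV_pressure:
  assumes "0 < y" "y \<noteq> b"
  shows "(pressure \<gamma>\<^sub>1 \<gamma>\<^sub>2 b has_real_derivative slope_max \<gamma>\<^sub>1 \<gamma>\<^sub>2 b y) (at y)"
  using DERIV_pressure_below[of y b] DERIV_pressure_above[of y b] assms
  by (auto simp: slope_max_def)

lemma power_slope_eq_square:
  assumes "0 < \<gamma>" "0 < y"
  shows "power_slope \<gamma> y = - (sqrt \<gamma> * y powr (- (\<gamma> + 1) / 2))\<^sup>2"
proof -
  have "(y powr (- (\<gamma> + 1) / 2))\<^sup>2 = y powr (- \<gamma> - 1)"
    by (simp add: power2_eq_square flip: powr_add)
  then show ?thesis using assms by (simp add: power_slope_def power_mult_distrib)
qed

text \<open>The speed interpolates linearly between its two one-sided values, the slope is minus its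
  square.\<close>

lemma slopes_eq_squared_speeds:
  assumes pos: "0 < \<gamma>\<^sub>1" "0 < \<gamma>\<^sub>2" "0 < y"
    and kink: "power_slope \<gamma>\<^sub>1 b < power_slope \<gamma>\<^sub>2 b"
  shows "{slope_min \<gamma>\<^sub>1 \<gamma>\<^sub>2 b y..slope_max \<gamma>\<^sub>1 \<gamma>\<^sub>2 b y} =
    (\<lambda>\<sigma>. - (characteristic_speed \<gamma>\<^sub>1 \<gamma>\<^sub>2 \<sigma> y)\<^sup>2) ` gen_sgn (y - b)"
proof -
  define a1 where "a1 = sqrt \<gamma>\<^sub>1 * y powr (- (\<gamma>\<^sub>1 + 1) / 2)"
  define a2 where "a2 = sqrt \<gamma>\<^sub>2 * y powr (- (\<gamma>\<^sub>2 + 1) / 2)"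
  have s1: "power_slope \<gamma>\<^sub>1 y = - a1\<^sup>2" and s2: "power_slope \<gamma>\<^sub>2 y = - a2\<^sup>2"
    using power_slope_eq_square pos by (auto simp: a1_def a2_def)
  have a: "0 < a1" "0 < a2" using pos by (auto simp: a1_def a2_def)
  have speed: "characteristic_speed \<gamma>\<^sub>1 \<gamma>\<^sub>2 \<sigma> y = - ((1 - \<sigma>) / 2 * a1 + (1 + \<sigma>) / 2 * a2)" for \<sigma>
    by (simp add: characteristic_speed_def a1_def a2_def field_simps)
  consider "y < b" | "b < y" | "y = b" by linarith
  then show ?thesis
  proof cases
    case 3
    then have "a2\<^sup>2 < a1\<^sup>2" using kink s1 s2 by simp
    then have a21: "a2 < a1" using a by (simp add: power2_less_imp_less)
    have "{- a1\<^sup>2 .. - a2\<^sup>2} = (\<lambda>\<sigma>. - (characteristic_speed \<gamma>\<^sub>1 \<gamma>\<^sub>2 \<sigma> y)\<^sup>2) ` {-1..1}"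
    proof (intro equalityI subsetI)
      fix c assume c: "c \<in> {- a1\<^sup>2 .. - a2\<^sup>2}"
      define r where "r = sqrt (- c)"
      have "a2\<^sup>2 \<le> - c" "- c \<le> a1\<^sup>2" using c by auto
      moreover from calculation have "0 \<le> - c" using zero_le_power2[of a2] by linarith
      ultimately have r: "a2 \<le> r" "r \<le> a1" "c = - r\<^sup>2"
        using a real_le_rsqrt[of a2 "- c"] real_le_lsqrt[of a1 "- c"] unfolding r_def by auto
      \<comment> \<open>The solution of
        \<open>(1 - \<sigma>) / 2 * a1 + (1 + \<sigma>) / 2 * a2 = r\<close>; the denominator is
        positive because the wave is faster on the left of the kink.\<close>
      define \<sigma> where "\<sigma> = (a1 + a2 - 2 * r) / (a1 - a2)"
      have "\<sigma> * (a1 - a2) = a1 + a2 - 2 * r" using a21 by (simp add: \<sigma>_def)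
      then have "characteristic_speed \<gamma>\<^sub>1 \<gamma>\<^sub>2 \<sigma> y = - r"
        unfolding speed by (simp add: field_simps)
      moreover have "\<sigma> \<in> {-1..1}" using a21 r by (auto simp: \<sigma>_def field_simps)
      ultimately show "c \<in> (\<lambda>\<sigma>. - (characteristic_speed \<gamma>\<^sub>1 \<gamma>\<^sub>2 \<sigma> y)\<^sup>2) ` {-1..1}"
        using r(3) by (intro image_eqI[of _ _ \<sigma>]) auto
    next
      fix c assume "c \<in> (\<lambda>\<sigma>. - (characteristic_speed \<gamma>\<^sub>1 \<gamma>\<^sub>2 \<sigma> y)\<^sup>2) ` {-1..1}"
      then obtain \<sigma> where \<sigma>: "-1 \<le> \<sigma>" "\<sigma> \<le> 1" and c: "c = - (characteristic_speed \<gamma>\<^sub>1 \<gamma>\<^sub>2 \<sigma> y)\<^sup>2"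
        by auto
      define r where "r = (1 - \<sigma>) / 2 * a1 + (1 + \<sigma>) / 2 * a2"
      have "r = a2 + (1 - \<sigma>) / 2 * (a1 - a2)" "r = a1 - (1 + \<sigma>) / 2 * (a1 - a2)"
        by (simp_all add: r_def field_simps)
      moreover have "0 \<le> (1 - \<sigma>) / 2 * (a1 - a2)" "0 \<le> (1 + \<sigma>) / 2 * (a1 - a2)"
        using \<sigma> a21 by simp_all
      ultimately have "a2 \<le> r" "r \<le> a1" by linarith+
      then have "a2\<^sup>2 \<le> r\<^sup>2" "r\<^sup>2 \<le> a1\<^sup>2" using a by (auto intro!: power_mono)
      then show "c \<in> {- a1\<^sup>2 .. - a2\<^sup>2}" unfolding c speed r_def[symmetric] by simp
    qed
    with 3 show ?thesis by (simp add: slope_min_def slope_max_def s1[unfolded 3] s2[unfolded 3] gen_sgn_def)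
  qed (auto simp: slope_min_def slope_max_def gen_sgn_def speed s1 s2)
qed

section \<open>Generalized Jacobian of the diagonalized flux\<close>

lemma vblock_stack [simp]: "vblock (stack u v) = v"
  and ublock_stack [simp]: "ublock (stack u v) = u"
  by (simp_all add: vec_eq_iff)

lemma stack_blocks [simp]: "stack (ublock w) (vblock w) = w"
  by (simp add: vec_plus_eq_iff)

lemma has_derivative_vec_nth_iff:
  fixes f :: "'a::real_normed_vector \<Rightarrow> real ^ 'm"
  shows "(f has_derivative f') (at x within X) \<longleftrightarrow>
    (\<forall>i. ((\<lambda>x. f x $ i) has_derivative (\<lambda>h. f' h $ i)) (at x within X))"
  by (subst has_derivative_componentwise_within) (auto simp: Basis_vec_def inner_axis)

lemma convex_hull_unit_cube: "convex hull {t :: real ^ 'n. \<forall>l. t $ l = 0 \<or> t $ l = 1} = cbox 0 1"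
proof -
  have "(\<Sum>Basis :: real ^ 'n) = 1"
  proof (rule euclidean_eqI)
    fix i :: "real ^ 'n" assume i: "i \<in> Basis"
    then obtain l where "i = axis l 1" by (auto simp: Basis_vec_def)
    then have "1 \<bullet> i = 1" by (simp add: inner_axis)
    with i show "(\<Sum>Basis) \<bullet> i = 1 \<bullet> i" by (simp add: inner_sum_left inner_Basis)
  qed
  moreover have "{t :: real ^ 'n. \<forall>i\<in>Basis. t \<bullet> i = 0 \<or> t \<bullet> i = 1} = {t. \<forall>l. t $ l = 0 \<or> t $ l = 1}"
    by (auto simp: Basis_vec_def inner_axis)
  ultimately show ?thesis using unit_interval_convex_hull[where 'a = "real ^ 'n"] by simp
qed

text \<open>All that remains of the Haar structure is a pair of inverse matrices. In the application
  \<open>S\<close> is \<open>A\<close> divided by \<open>CARD('n)\<close>, \<open>R\<close> is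
  \<open>transpose A\<close>, and \<open>b\<close> holds the cell values of
  \<open>vs\<close>.\<close>

locale diagonalized_wave =
  fixes \<gamma>\<^sub>1 \<gamma>\<^sub>2 :: real and b :: "real ^ 'n" and S R :: "real ^ 'n ^ 'n"
  assumes SR: "S ** R = mat 1" and RS: "R ** S = mat 1"
    and \<gamma>_pos: "0 < \<gamma>\<^sub>1" "0 < \<gamma>\<^sub>2" and b_pos: "\<And>l. 0 < b $ l"
    and kink: "\<And>l. power_slope \<gamma>\<^sub>1 (b $ l) < power_slope \<gamma>\<^sub>2 (b $ l)"
begin

definition y :: "real ^ ('n + 'n) \<Rightarrow> real ^ 'n" where
  "y w = R *v vblock w"

definition F :: "real ^ ('n + 'n) \<Rightarrow> real ^ ('n + 'n)" where
  "F w = stack (S *v (\<chi> l. pressure \<gamma>\<^sub>1 \<gamma>\<^sub>2 (b $ l) (y w $ l))) (- ublock w)"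

definition J :: "real ^ 'n \<Rightarrow> real ^ ('n + 'n) ^ ('n + 'n)" where
  "J c = block 0 (S ** diagonal c ** R) (- mat 1) 0"

definition lower :: "real ^ ('n + 'n) \<Rightarrow> real ^ 'n" where
  "lower w = (\<chi> l. slope_min \<gamma>\<^sub>1 \<gamma>\<^sub>2 (b $ l) (y w $ l))"

definition upper :: "real ^ ('n + 'n) \<Rightarrow> real ^ 'n" where
  "upper w = (\<chi> l. slope_max \<gamma>\<^sub>1 \<gamma>\<^sub>2 (b $ l) (y w $ l))"

lemma y_nth: "y w $ l = (\<Sum>a\<in>UNIV. R $ l $ a * w $ Inr a)"
  by (simp add: y_def matrix_vector_mult_def)

lemma y_stack: "y (stack u (S *v z)) = z"
  by (simp add: y_def matrix_vector_mul_assoc RS)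

lemma S_y: "S *v y w = vblock w"
  by (simp add: y_def matrix_vector_mul_assoc SR)

lemma tendsto_y: "(X \<longlongrightarrow> w) G \<Longrightarrow> ((\<lambda>n. y (X n) $ l) \<longlongrightarrow> y w $ l) G"
  unfolding y_nth by (intro tendsto_intros)

lemma lower_le_upper: "lower w $ l \<le> upper w $ l"
  using kink[of l] by (auto simp: lower_def upper_def slope_min_def slope_max_def)

lemma J_vector: "J c *v h = stack (S *v (\<chi> l. c $ l * y h $ l)) (- ublock h)"
proof -
  have "- mat 1 *v ublock h = - ublock h"
    by (simp add: mat_eq_diagonal minus_diagonal vec_eq_iff diagonal_vector_nth)
  moreover have "diagonal c *v y h = (\<chi> l. c $ l * y h $ l)"
    by (simp add: vec_eq_iff diagonal_vector_nth)
  ultimately show ?thesis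
    by (simp add: J_def block_vector y_def matrix_vector_mul_assoc[symmetric])
qed

lemma F_has_derivative:
  assumes "\<And>l. 0 < y w $ l" "\<And>l. y w $ l \<noteq> b $ l"
  shows "(F has_derivative (\<lambda>h. J (upper w) *v h)) (at w)"
  unfolding has_derivative_vec_nth_iff
proof
  fix i :: "'n + 'n"
  have yl: "((\<lambda>w. y w $ l) has_derivative (\<lambda>h. y h $ l)) (at w)" for l
    unfolding y_nth by (intro has_derivative_sum has_derivative_mult_right bounded_linear_imp_has_derivative bounded_linear_vec_nth)
  have "((\<lambda>w. pressure \<gamma>\<^sub>1 \<gamma>\<^sub>2 (b $ l) (y w $ l)) has_derivative (\<lambda>h. upper w $ l * y h $ l)) (at w)" for l
  proof -
    have "(pressure \<gamma>\<^sub>1 \<gamma>\<^sub>2 (b $ l) has_derivative (\<lambda>t. upper w $ l * t)) (at (y w $ l))"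
      using DERIV_pressure[OF assms] by (simp add: has_field_derivative_def upper_def)
    then show ?thesis by (rule has_derivative_compose[OF yl])
  qed
  note p = this
  show "((\<lambda>w. F w $ i) has_derivative (\<lambda>h. (J (upper w) *v h) $ i)) (at w)"
  proof (cases i)
    case (Inl a)
    have "((\<lambda>w. \<Sum>l\<in>UNIV. S $ a $ l * pressure \<gamma>\<^sub>1 \<gamma>\<^sub>2 (b $ l) (y w $ l)) has_derivative
        (\<lambda>h. \<Sum>l\<in>UNIV. S $ a $ l * (upper w $ l * y h $ l))) (at w)"
      by (intro has_derivative_sum has_derivative_mult_right p)
    then show ?thesis
      by (simp add: Inl F_def J_vector) (simp add: matrix_vector_mult_def)
  next
    case (Inr a)
    have "((\<lambda>w. - w $ Inl a) has_derivative (\<lambda>h. - h $ Inl a)) (at w)"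
      by (intro has_derivative_minus bounded_linear_imp_has_derivative bounded_linear_vec_nth)
    then show ?thesis by (simp add: Inr F_def J_vector)
  qed
qed

lemma jacobian_F:
  assumes "\<And>l. 0 < y w $ l" "\<And>l. y w $ l \<noteq> b $ l"
  shows "F differentiable (at w)" "jacobian F (at w) = J (upper w)"
proof -
  show "F differentiable (at w)"
    using F_has_derivative[OF assms] by (auto simp: differentiable_def)
  show "jacobian F (at w) = J (upper w)"
    unfolding jacobian_def frechet_derivative_at[OF F_has_derivative[OF assms], symmetric] by simp
qed

text \<open>Along the line through \<open>w\<close> that moves only the \<open>l\<close>-th cell value, \<open>F\<close> reproduces the
  scalar pressure law.\<close>

lemma F_differentiable_imp_no_kink:
  assumes "F differentiable (at w)"
  shows "y w $ l \<noteq> b $ l"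
proof
  assume eq: "y w $ l = b $ l"
  \<comment> \<open>The direction has \<open>axis l 1\<close> as cell values and the shift puts
    \<open>w\<close> at parameter \<open>b $ l\<close>, so \<open>t\<close> itself is the
    \<open>l\<close>-th cell value of \<open>W t\<close>.\<close>
  define W where "W t = w + (t - b $ l) *\<^sub>R stack 0 (S *v axis l 1)" for t
  have Wb: "W (b $ l) = w" by (simp add: W_def)
  have "W differentiable (at (b $ l))"
    unfolding W_def by (intro derivative_intros)
  moreover have "F differentiable (at (W (b $ l)))" using assms by (simp add: Wb)
  ultimately have FW: "(\<lambda>t. F (W t)) differentiable (at (b $ l))"
    by (rule differentiable_compose[rotated])
  \<comment> \<open>Row \<open>l\<close> of \<open>R\<close> undoes \<open>S\<close> on the first
    block and extracts the pressure in cell \<open>l\<close>; being linear, it preserves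
    differentiability.\<close>
  have "(\<lambda>v. \<Sum>a\<in>UNIV. R $ l $ a * v $ Inl a) differentiable (at (F (W (b $ l))))"
    by (intro bounded_linear_imp_differentiable bounded_linear_sum bounded_linear_const_mult bounded_linear_vec_nth)
  then have "(\<lambda>t. \<Sum>a\<in>UNIV. R $ l $ a * F (W t) $ Inl a) differentiable (at (b $ l))"
    by (rule differentiable_compose[OF _ FW])
  moreover have "(\<Sum>a\<in>UNIV. R $ l $ a * F (W t) $ Inl a) = pressure \<gamma>\<^sub>1 \<gamma>\<^sub>2 (b $ l) t" for t
  proof -
    have "vblock (W t) = S *v (y w + (t - b $ l) *\<^sub>R axis l 1)"
      by (simp add: W_def vec_eq_iff matrix_vector_right_distrib matrix_vector_mult_scaleR S_y)
    then have "y (W t) = y w + (t - b $ l) *\<^sub>R axis l 1"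
      by (simp add: y_def matrix_vector_mul_assoc RS)
    then have yl: "y (W t) $ l = t" by (simp add: eq)
    have "(\<Sum>a\<in>UNIV. R $ l $ a * F (W t) $ Inl a) = (R *v ublock (F (W t))) $ l"
      by (simp add: matrix_vector_mult_def)
    also have "\<dots> = pressure \<gamma>\<^sub>1 \<gamma>\<^sub>2 (b $ l) t"
      by (simp add: F_def matrix_vector_mul_assoc RS yl)
    finally show ?thesis .
  qed
  ultimately have "pressure \<gamma>\<^sub>1 \<gamma>\<^sub>2 (b $ l) differentiable (at (b $ l))" by simp
  then show False using pressure_not_differentiable b_pos kink by (metis less_irrefl)
qed

text \<open>The diagonal of \<open>R ** P ** S\<close> for the upper right block \<open>P\<close>: a
  left inverse of \<open>J\<close>, continuous on all matrices, so convergence of Jacobians forces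
  convergence of the slopes.\<close>

definition slopes_of :: "real ^ ('n + 'n) ^ ('n + 'n) \<Rightarrow> real ^ 'n" where
  "slopes_of M = (\<chi> l. \<Sum>a\<in>UNIV. \<Sum>d\<in>UNIV. R $ l $ a * M $ Inl a $ Inr d * S $ d $ l)"

lemma slopes_of_J: "slopes_of (J c) = c"
proof -
  have "slopes_of (J c) $ l = c $ l" for l
  proof -
    have "slopes_of (J c) $ l = (R ** (S ** diagonal c ** R) ** S) $ l $ l"
    proof -
      have "(P ** S) $ l $ l = (\<Sum>d\<in>UNIV. P $ l $ d * S $ d $ l)" for P :: "real ^ 'n ^ 'n"
        by (simp add: matrix_matrix_mult_def)
      moreover have "(R ** Q) $ l $ d = (\<Sum>a\<in>UNIV. R $ l $ a * Q $ a $ d)" for Q :: "real ^ 'n ^ 'n" and d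
        by (simp add: matrix_matrix_mult_def)
      ultimately show ?thesis
        unfolding slopes_of_def J_def vec_lambda_beta block_nth
        by (simp only: sum_distrib_right) (rule sum.swap)
    qed
    also have "R ** (S ** diagonal c ** R) ** S = (R ** S) ** diagonal c ** (R ** S)"
      by (simp add: matrix_mul_assoc)
    finally show ?thesis by (simp add: RS diagonal_def)
  qed
  then show ?thesis by (simp add: vec_eq_iff)
qed

lemma tendsto_slopes_of: "(X \<longlongrightarrow> M) G \<Longrightarrow> ((\<lambda>n. slopes_of (X n)) \<longlongrightarrow> slopes_of M) G"
  unfolding slopes_of_def by (intro tendsto_intros)

lemma J_nth_Inl_Inr: "J c $ Inl a $ Inr d = (\<Sum>l\<in>UNIV. S $ a $ l * c $ l * R $ l $ d)"
  by (subst J_def) (simp add: matrix_matrix_mult_def[of _ R] mult_diagonal_nth)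

lemma J_nth_other:
  "J c $ Inl a $ Inl d = 0" "J c $ Inr a $ i = (if i = Inl a then -1 else 0)"
  by (cases i; auto simp: J_def mat_def)+

lemma tendsto_J:
  assumes "(c \<longlongrightarrow> c') G"
  shows "((\<lambda>n. J (c n)) \<longlongrightarrow> J c') G"
proof (intro vec_tendstoI)
  fix i j :: "'n + 'n"
  show "((\<lambda>n. J (c n) $ i $ j) \<longlongrightarrow> J c' $ i $ j) G"
  proof (cases i)
    case (Inl a)
    then show ?thesis
      by (cases j) (auto simp: J_nth_Inl_Inr J_nth_other intro!: tendsto_intros assms)
  next
    case (Inr a)
    then show ?thesis by (simp add: J_nth_other)
  qed
qed

definition limit_slopes :: "real ^ ('n + 'n) \<Rightarrow> (real ^ 'n) set" where
  "limit_slopes w = {c. \<forall>l. c $ l \<in> {lower w $ l, upper w $ l}}"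

definition limit_jacobians :: "real ^ ('n + 'n) \<Rightarrow> (real ^ ('n + 'n) ^ ('n + 'n)) set" where
  "limit_jacobians w = {M. \<exists>X. (\<forall>n. F differentiable (at (X n))) \<and> X \<longlonglongrightarrow> w \<and>
     (\<lambda>n. jacobian F (at (X n))) \<longlonglongrightarrow> M}"

text \<open>Differentiability excludes kinks along the sequence, so its Jacobians eventually have
  the form \<open>J (upper _)\<close>. Continuity of \<open>J\<close> and \<open>slopes_of\<close>
  carries this form to the limit.\<close>

lemma limit_jacobians_subset:
  assumes pos: "\<And>l. 0 < y w $ l"
  shows "limit_jacobians w \<subseteq> J ` limit_slopes w"
proof
  fix M assume "M \<in> limit_jacobians w"
  then obtain X where X: "\<And>n. F differentiable (at (X n))" "X \<longlonglongrightarrow> w"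
    and M: "(\<lambda>n. jacobian F (at (X n))) \<longlonglongrightarrow> M"
    unfolding limit_jacobians_def by blast
  \<comment> \<open>The sequence may start outside the positive cone, where the formula for the
    Jacobian has not been established.\<close>
  have "eventually (\<lambda>n. \<forall>l. 0 < y (X n) $ l) sequentially"
    using order_tendstoD(1)[OF tendsto_y[OF X(2)] pos] by (simp add: eventually_all_finite)
  then have ev: "eventually (\<lambda>n. jacobian F (at (X n)) = J (upper (X n))) sequentially"
    by eventually_elim (use F_differentiable_imp_no_kink[OF X(1)] in \<open>auto intro: jacobian_F(2)\<close>)
  have JM: "(\<lambda>n. J (upper (X n))) \<longlonglongrightarrow> M"
    using M by (rule Lim_transform_eventually) (use ev in simp)
  then have up: "(\<lambda>n. upper (X n)) \<longlonglongrightarrow> slopes_of M"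
    using tendsto_slopes_of[OF JM] by (simp add: slopes_of_J)
  have "M = J (slopes_of M)"
    using LIMSEQ_unique[OF JM tendsto_J[OF up]] .
  moreover have "slopes_of M \<in> limit_slopes w"
    unfolding limit_slopes_def
  proof (intro CollectI allI)
    fix l
    have upl: "(\<lambda>n. upper (X n) $ l) \<longlonglongrightarrow> slopes_of M $ l" by (intro tendsto_intros up)
    have s: "(\<lambda>n. power_slope \<gamma> (y (X n) $ l)) \<longlonglongrightarrow> power_slope \<gamma> (y w $ l)" for \<gamma>
      by (intro tendsto_power_slope tendsto_y X pos)
    consider "y w $ l < b $ l" | "b $ l < y w $ l" | "y w $ l = b $ l" by linarith
    then show "slopes_of M $ l \<in> {lower w $ l, upper w $ l}"
    proof cases
      case 1
      have "eventually (\<lambda>n. power_slope \<gamma>\<^sub>1 (y (X n) $ l) = upper (X n) $ l) sequentially"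
        using order_tendstoD(2)[OF tendsto_y[OF X(2)] 1]
        by (elim eventually_mono) (simp add: upper_def slope_max_def)
      then have "(\<lambda>n. upper (X n) $ l) \<longlonglongrightarrow> power_slope \<gamma>\<^sub>1 (y w $ l)"
        by (rule Lim_transform_eventually[OF s])
      then show ?thesis using LIMSEQ_unique[OF upl] 1 by (simp add: upper_def slope_max_def)
    next
      case 2
      have "eventually (\<lambda>n. power_slope \<gamma>\<^sub>2 (y (X n) $ l) = upper (X n) $ l) sequentially"
        using order_tendstoD(1)[OF tendsto_y[OF X(2)] 2]
        by (elim eventually_mono) (simp add: upper_def slope_max_def)
      then have "(\<lambda>n. upper (X n) $ l) \<longlonglongrightarrow> power_slope \<gamma>\<^sub>2 (y w $ l)"
        by (rule Lim_transform_eventually[OF s])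
      then show ?thesis using LIMSEQ_unique[OF upl] 2 by (simp add: upper_def slope_max_def)
    next
      case 3
      \<comment> \<open>The sequence may change sides infinitely often, so neither branch need hold
        eventually. The product of the two differences vanishes for every \<open>n\<close>, hence
        also in the limit.\<close>
      have "(\<lambda>n. (upper (X n) $ l - power_slope \<gamma>\<^sub>1 (y (X n) $ l)) * (upper (X n) $ l - power_slope \<gamma>\<^sub>2 (y (X n) $ l)))
          \<longlonglongrightarrow> (slopes_of M $ l - power_slope \<gamma>\<^sub>1 (y w $ l)) * (slopes_of M $ l - power_slope \<gamma>\<^sub>2 (y w $ l))"
        by (intro tendsto_intros upl s)
      moreover have "(\<lambda>n. (upper (X n) $ l - power_slope \<gamma>\<^sub>1 (y (X n) $ l)) * (upper (X n) $ l - power_slope \<gamma>\<^sub>2 (y (X n) $ l))) = (\<lambda>n. 0)"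
        by (simp add: upper_def slope_max_def fun_eq_iff)
      ultimately have "(slopes_of M $ l - power_slope \<gamma>\<^sub>1 (y w $ l)) * (slopes_of M $ l - power_slope \<gamma>\<^sub>2 (y w $ l)) = 0"
        by (simp add: LIMSEQ_const_iff)
      then show ?thesis using 3 by (auto simp: lower_def upper_def slope_min_def slope_max_def)
    qed
  qed
  ultimately show "M \<in> J ` limit_slopes w" by blast
qed

text \<open>Cell values can be moved independently through \<open>S\<close>, so each kinked cell is
  approached from the side that produces the prescribed slope.\<close>

lemma limit_jacobians_supset:
  assumes pos: "\<And>l. 0 < y w $ l"
  shows "J ` limit_slopes w \<subseteq> limit_jacobians w"
proof
  fix M assume "M \<in> J ` limit_slopes w"
  then obtain c where M: "M = J c" and c: "\<And>l. c $ l \<in> {lower w $ l, upper w $ l}"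
    unfolding limit_slopes_def by auto
  define \<sigma> :: "'n \<Rightarrow> real" where
    "\<sigma> l = (if y w $ l \<noteq> b $ l then 0 else if c $ l = lower w $ l then -1 else 1)" for l
  \<comment> \<open>Starting at \<open>1 / 2\<close> keeps \<open>1 - e n\<close> positive; the
    perturbation below is relative, so cell values stay positive on either side.\<close>
  define e :: "nat \<Rightarrow> real" where "e n = inverse (real (Suc (Suc n)))" for n
  have e: "0 < e n" "e n < 1" for n by (auto simp: e_def inverse_eq_divide)
  have e0: "e \<longlonglongrightarrow> 0"
    unfolding e_def using LIMSEQ_Suc[OF LIMSEQ_inverse_real_of_nat] .
  define Y where "Y n = (\<chi> l. y w $ l * (1 + \<sigma> l * e n))" for n
  define X where "X n = stack (ublock w) (S *v Y n)" for n
  have yX: "y (X n) = Y n" for n by (simp add: X_def y_stack)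
  have Ypos: "0 < Y n $ l" for n l
  proof -
    have "0 < 1 + \<sigma> l * e n" using e[of n] by (auto simp: \<sigma>_def)
    then show ?thesis using pos[of l] by (simp add: Y_def)
  qed
  have Yb: "Y n $ l \<noteq> b $ l" for n l
    using e[of n] b_pos[of l] by (auto simp: Y_def \<sigma>_def)
  have Yl: "(\<lambda>n. Y n $ l) \<longlonglongrightarrow> y w $ l" for l
  proof -
    have "(\<lambda>n. y w $ l * (1 + \<sigma> l * e n)) \<longlonglongrightarrow> y w $ l * (1 + \<sigma> l * 0)"
      by (intro tendsto_intros e0)
    then show ?thesis by (simp add: Y_def)
  qed
  have "X \<longlonglongrightarrow> w"
  proof (rule vec_tendstoI)
    fix i :: "'n + 'n"
    show "(\<lambda>n. X n $ i) \<longlonglongrightarrow> w $ i"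
    proof (cases i)
      case (Inr a)
      have "(\<lambda>n. \<Sum>l\<in>UNIV. S $ a $ l * Y n $ l) \<longlonglongrightarrow> (\<Sum>l\<in>UNIV. S $ a $ l * y w $ l)"
        by (intro tendsto_intros Yl)
      also have "(\<Sum>l\<in>UNIV. S $ a $ l * y w $ l) = (S *v y w) $ a" by (simp add: matrix_vector_mult_def)
      finally show ?thesis by (simp add: Inr X_def S_y) (simp add: matrix_vector_mult_def)
    qed (simp add: X_def)
  qed
  moreover have "F differentiable (at (X n))" "jacobian F (at (X n)) = J (upper (X n))" for n
    using jacobian_F[of "X n"] Ypos Yb by (simp_all add: yX)
  moreover have "(\<lambda>n. J (upper (X n))) \<longlonglongrightarrow> M"
    unfolding M
  proof (intro tendsto_J vec_tendstoI)
    fix l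
    have s: "(\<lambda>n. power_slope \<gamma> (Y n $ l)) \<longlonglongrightarrow> power_slope \<gamma> (y w $ l)" for \<gamma>
      by (intro tendsto_power_slope Yl pos)
    show "(\<lambda>n. upper (X n) $ l) \<longlonglongrightarrow> c $ l"
    proof (cases "y w $ l = b $ l")
      case False
      then have "Y n $ l = y w $ l" for n by (simp add: Y_def \<sigma>_def)
      moreover have "c $ l = upper w $ l"
        using c[of l] False by (auto simp: lower_def upper_def slope_min_def slope_max_def)
      ultimately show ?thesis by (simp add: upper_def yX)
    next
      case True
      show ?thesis
      proof (cases "c $ l = lower w $ l")
        case low: True
        then have "Y n $ l < b $ l" for n
          using e[of n] True b_pos[of l] by (simp add: Y_def \<sigma>_def)
        then show ?thesis using s[of \<gamma>\<^sub>1] low True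
          by (simp add: upper_def lower_def slope_max_def slope_min_def yX)
      next
        case high: False
        then have "\<not> Y n $ l < b $ l" for n
          using e[of n] True b_pos[of l] by (simp add: Y_def \<sigma>_def)
        moreover have "c $ l = power_slope \<gamma>\<^sub>2 (b $ l)"
          using c[of l] high True by (simp add: upper_def slope_max_def)
        ultimately show ?thesis using s[of \<gamma>\<^sub>2] True
          by (simp add: upper_def slope_max_def yX)
      qed
    qed
  qed
  ultimately show "M \<in> limit_jacobians w"
    unfolding limit_jacobians_def by (intro CollectI exI[of _ X]) simp
qed

text \<open>The limiting slopes are the vertices of a possibly degenerate box, that is, the image of the
  vertices of the unit cube under an affine map.\<close>

lemma gen_jacobian_F:
  assumes pos: "\<And>l. 0 < y w $ l"
  shows "gen_jacobian F w = J ` cbox (lower w) (upper w)"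
proof -
  \<comment> \<open>The linear part of \<open>J o ?f\<close>; the constant block
    \<open>- mat 1\<close> is left to the translation by \<open>J (lower w)\<close>. Convex hulls
    commute with both maps.\<close>
  define L where "L t = block 0 (S ** diagonal (t * (upper w - lower w)) ** R) 0 0" for t
  let ?V = "{t :: real ^ 'n. \<forall>l. t $ l = 0 \<or> t $ l = 1}"
  let ?f = "\<lambda>t. lower w + t * (upper w - lower w)"
  have L_nth: "L t $ Inl a $ Inr d = (\<Sum>l\<in>UNIV. S $ a $ l * (t * (upper w - lower w)) $ l * R $ l $ d)" for t a d
    unfolding L_def by (simp add: matrix_matrix_mult_def[of _ R] mult_diagonal_nth)
  have L_other: "L t $ Inl a $ Inl d = 0" "L t $ Inr a = 0" for t a d
    by (auto simp: L_def vec_plus_eq_iff)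
  have "linear L"
    by (rule linearI)
      (simp_all add: vec_plus_eq_iff L_nth L_other sum.distrib sum_subtractf sum_distrib_left algebra_simps)
  have JL: "J (?f t) = J (lower w) + L t" for t
    unfolding vec_eq_iff[of "J _"]
  proof
    fix i show "J (?f t) $ i = (J (lower w) + L t) $ i"
      by (cases i) (simp_all add: vec_plus_eq_iff J_nth_Inl_Inr J_nth_other L_nth L_other
          sum.distrib sum_subtractf algebra_simps)
  qed
  have J_image: "J ` ?f ` T = (\<lambda>M. J (lower w) + M) ` L ` T" for T
    by (simp add: image_image JL)
  have "limit_slopes w = ?f ` ?V"
  proof (intro equalityI subsetI)
    fix c assume "c \<in> limit_slopes w"
    then have "c = ?f (\<chi> l. if c $ l = lower w $ l then 0 else 1)"
      by (auto simp: limit_slopes_def vec_eq_iff)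
    then show "c \<in> ?f ` ?V" by (rule image_eqI) auto
  qed (auto simp: limit_slopes_def)
  moreover have "cbox (lower w) (upper w) = ?f ` cbox 0 1"
  proof (intro equalityI subsetI)
    fix c assume c: "c \<in> cbox (lower w) (upper w)"
    \<comment> \<open>In a degenerate coordinate the division by zero gives 0, which is a valid
      choice because \<open>c\<close> equals \<open>lower w\<close> there.\<close>
    let ?t = "\<chi> l. (c $ l - lower w $ l) / (upper w $ l - lower w $ l)"
    have "c $ l = ?f ?t $ l" "0 \<le> ?t $ l" "?t $ l \<le> 1" for l
      using c[unfolded mem_box_cart] lower_le_upper[of w l]
      by (cases "lower w $ l = upper w $ l"; force simp: divide_le_eq_1 intro: antisym)+
    then have "c = ?f ?t" "?t \<in> cbox 0 1" by (simp_all add: vec_eq_iff mem_box_cart)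
    then show "c \<in> ?f ` cbox 0 1" by (rule image_eqI)
  next
    fix c assume "c \<in> ?f ` cbox 0 1"
    then obtain t where c: "c = ?f t" and t: "\<And>l. 0 \<le> t $ l" "\<And>l. t $ l \<le> 1"
      by (auto simp: mem_box_cart)
    have "t $ l * (upper w $ l - lower w $ l) \<le> 1 * (upper w $ l - lower w $ l)" for l
      using t lower_le_upper[of w l] by (intro mult_right_mono) auto
    then show "c \<in> cbox (lower w) (upper w)"
      using t lower_le_upper[of w] by (simp add: c mem_box_cart le_diff_eq add.commute)
  qed
  moreover have "limit_jacobians w = J ` limit_slopes w"
    using limit_jacobians_subset limit_jacobians_supset pos by blast
  moreover have "gen_jacobian F w = convex hull (limit_jacobians w)"
    by (simp add: gen_jacobian_def limit_jacobians_def)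
  ultimately show ?thesis
    by (simp only: J_image convex_hull_translation convex_hull_linear_image[OF \<open>linear L\<close>, symmetric]
        convex_hull_unit_cube)
qed

end

section \<open>Spectra of the generalized Jacobian\<close>

context diagonalized_wave
begin

lemma spectrum_of_J:
  assumes "\<And>l. c $ l = - (characteristic_speed \<gamma>\<^sub>1 \<gamma>\<^sub>2 (\<sigma> $ l) (y w $ l))\<^sup>2"
  shows "spectrum_of (J c) = (\<Sum>l\<in>UNIV.
    {# complex_of_real (characteristic_speed \<gamma>\<^sub>1 \<gamma>\<^sub>2 (\<sigma> $ l) (y w $ l)),
       - complex_of_real (characteristic_speed \<gamma>\<^sub>1 \<gamma>\<^sub>2 (\<sigma> $ l) (y w $ l)) #})"
proof -
  define m where "m = (\<chi> l. characteristic_speed \<gamma>\<^sub>1 \<gamma>\<^sub>2 (\<sigma> $ l) (y w $ l))"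
  have m: "characteristic_speed \<gamma>\<^sub>1 \<gamma>\<^sub>2 (\<sigma> $ l) (y w $ l) = m $ l" for l
    by (simp add: m_def)
  show ?thesis
    unfolding J_def m by (rule spectrum_of_wave[OF SR]) (use assms m in simp)
qed

text \<open>The box of slopes and the set of admissible signs are both products over the cells, so
  slopes can be traded for signs in each cell separately.\<close>

lemma spectrum_gen_jacobian:
  assumes pos: "\<And>l. 0 < y w $ l"
  shows "spectrum_of ` gen_jacobian F w =
    (\<lambda>\<sigma>. \<Sum>l\<in>UNIV.
      {# complex_of_real (characteristic_speed \<gamma>\<^sub>1 \<gamma>\<^sub>2 (\<sigma> $ l) (y w $ l)),
         - complex_of_real (characteristic_speed \<gamma>\<^sub>1 \<gamma>\<^sub>2 (\<sigma> $ l) (y w $ l)) #}) `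
    {\<sigma>. \<forall>l. \<sigma> $ l \<in> gen_sgn (y w $ l - b $ l)}" (is "_ = ?f ` ?G")
proof -
  have slopes: "{lower w $ l..upper w $ l} =
      (\<lambda>\<sigma>. - (characteristic_speed \<gamma>\<^sub>1 \<gamma>\<^sub>2 \<sigma> (y w $ l))\<^sup>2) ` gen_sgn (y w $ l - b $ l)" for l
    using slopes_eq_squared_speeds[OF \<gamma>_pos pos kink] by (simp add: lower_def upper_def)
  have "spectrum_of ` J ` cbox (lower w) (upper w) = ?f ` ?G"
  proof (intro equalityI subsetI)
    fix X assume "X \<in> spectrum_of ` J ` cbox (lower w) (upper w)"
    then obtain c where X: "X = spectrum_of (J c)" and c: "\<And>l. c $ l \<in> {lower w $ l..upper w $ l}"
      by (auto simp: mem_box_cart)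
    have "\<exists>s. s \<in> gen_sgn (y w $ l - b $ l) \<and> c $ l = - (characteristic_speed \<gamma>\<^sub>1 \<gamma>\<^sub>2 s (y w $ l))\<^sup>2" for l
      using c[of l] unfolding slopes by blast
    then obtain s where s: "\<And>l. s l \<in> gen_sgn (y w $ l - b $ l)"
      "\<And>l. c $ l = - (characteristic_speed \<gamma>\<^sub>1 \<gamma>\<^sub>2 (s l) (y w $ l))\<^sup>2"
      by metis
    have "X = ?f (\<chi> l. s l)" unfolding X by (rule spectrum_of_J) (simp add: s)
    then show "X \<in> ?f ` ?G" by (rule image_eqI) (simp add: s)
  next
    fix X assume "X \<in> ?f ` ?G"
    then obtain \<sigma> where X: "X = ?f \<sigma>" and \<sigma>: "\<And>l. \<sigma> $ l \<in> gen_sgn (y w $ l - b $ l)" by blast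
    define c where "c = (\<chi> l. - (characteristic_speed \<gamma>\<^sub>1 \<gamma>\<^sub>2 (\<sigma> $ l) (y w $ l))\<^sup>2)"
    have "c $ l \<in> {lower w $ l..upper w $ l}" for l
      unfolding slopes c_def vec_lambda_beta using \<sigma> by (rule imageI)
    then have "c \<in> cbox (lower w) (upper w)" by (simp add: mem_box_cart)
    moreover have "X = spectrum_of (J c)"
      unfolding X by (rule spectrum_of_J[symmetric]) (simp add: c_def)
    ultimately show "X \<in> spectrum_of ` J ` cbox (lower w) (upper w)" by blast
  qed
  then show ?thesis by (simp add: gen_jacobian_F[OF pos])
qed

text \<open>Without kinks the box of slopes shrinks to a point.\<close>

lemma gen_jacobian_no_kink:
  assumes "\<And>l. 0 < y w $ l" "\<And>l. y w $ l \<noteq> b $ l"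
  shows "gen_jacobian F w = {jacobian F (at w)}"
proof -
  have "lower w = upper w"
    using assms(2) by (simp add: lower_def upper_def slope_min_def slope_max_def vec_eq_iff less_le)
  then show ?thesis
    by (simp add: gen_jacobian_F[OF assms(1)] jacobian_F(2)[OF assms] cbox_idem)
qed

end

section \<open>Return from cell values to gPC modes\<close>

lemma AE_expansion_imp_cell_values:
  assumes "AE \<xi> in unif01. P (expansion A v \<xi>)"
  shows "P (cell_values A v $ l)"
proof -
  obtain \<xi> where "\<xi> \<in> cell l" "P (expansion A v \<xi>)" using AE_unif01_cell[OF assms] .
  then show ?thesis by (simp only: expansion_cell)
qed

context
  fixes A :: "'n::{finite,linorder} rmat"
  assumes haar: "haar_type A"
begin

text \<open>Any vector of modes arises from the diagonal matrix of its own cell values, so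
  membership is a separate condition in each cell.\<close>

lemma gen_sign_modes_iff:
  "s \<in> gen_sign_modes A w \<longleftrightarrow> (\<forall>l. cell_values A s $ l \<in> gen_sgn (cell_values A w $ l))"
proof
  assume "s \<in> gen_sign_modes A w"
  then obtain M where s: "s = diag_modes A M" and off: "\<forall>i j. i \<noteq> j \<longrightarrow> M $ i $ j = 0"
    and M: "\<forall>i. M $ i $ i \<in> gen_sgn (cell_values A w $ i)"
    by (auto simp: gen_sign_modes_def eig_matrix_nth[OF haar])
  have "M = diagonal (\<chi> i. M $ i $ i)" using off by (simp add: diagonal_def vec_eq_iff)
  then have "cell_values A s = (\<chi> i. M $ i $ i)"
    unfolding s by (metis cell_values_diag_modes[OF haar])
  then show "\<forall>l. cell_values A s $ l \<in> gen_sgn (cell_values A w $ l)" using M by simp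
next
  assume *: "\<forall>l. cell_values A s $ l \<in> gen_sgn (cell_values A w $ l)"
  have "s = diag_modes A (diagonal (cell_values A s))"
    by (simp add: cell_values_inject[OF haar, symmetric] cell_values_diag_modes[OF haar])
  then show "s \<in> gen_sign_modes A w"
    unfolding gen_sign_modes_def using *
    by (intro CollectI exI[of _ "diagonal (cell_values A s)"])
      (auto simp: eig_matrix_nth[OF haar] diagonal_def)
qed

lemma Dp_half_nth:
  "Dp_half A \<gamma>\<^sub>1 \<gamma>\<^sub>2 s v $ i $ i =
     characteristic_speed \<gamma>\<^sub>1 \<gamma>\<^sub>2 (cell_values A s $ i) (cell_values A v $ i)"
  by (simp add: Dp_half_def characteristic_speed_def eig_matrix_eq[OF haar] diag_map_diagonal
      mult_diagonal_nth)
    (simp add: diagonal_def mat_def)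

text \<open>The value \<open>sgn 0 = 0\<close> lies in the interval \<open>{-1..1}\<close>, so the
  ordinary sign is an admissible selection even at a kink.\<close>

lemma sign_modes_in_gen_sign_modes: "sign_modes A w \<in> gen_sign_modes A w"
  by (simp add: gen_sign_modes_iff cell_values_sign_modes[OF haar] gen_sgn_def)

text \<open>A function of a step function is again a step function on the same cells, so its
  projection is exact.\<close>

lemma cell_values_pressure_jump:
  "cell_values A (modes A (\<lambda>\<xi>. pressure_jump \<gamma>\<^sub>1 \<gamma>\<^sub>2 (expansion A vs \<xi>))) $ l =
     pressure_jump \<gamma>\<^sub>1 \<gamma>\<^sub>2 (cell_values A vs $ l)"
proof -
  have "cell_values A (modes A (\<lambda>\<xi>. pressure_jump \<gamma>\<^sub>1 \<gamma>\<^sub>2 (expansion A vs \<xi>))) =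
      (\<chi> l. pressure_jump \<gamma>\<^sub>1 \<gamma>\<^sub>2 (cell_values A vs $ l))"
    by (rule cell_values_modes[OF haar]) (simp only: expansion_cell vec_lambda_beta)
  then show ?thesis by simp
qed

context
  fixes \<gamma>\<^sub>1 \<gamma>\<^sub>2 :: real and vs dvs :: "'n rvec"
  assumes dvs: "dvs = modes A (\<lambda>\<xi>. pressure_jump \<gamma>\<^sub>1 \<gamma>\<^sub>2 (expansion A vs \<xi>))"
begin

lemma cell_values_pressure_modes:
  "cell_values A (pressure_modes A \<gamma>\<^sub>1 \<gamma>\<^sub>2 vs dvs v) $ l =
     pressure \<gamma>\<^sub>1 \<gamma>\<^sub>2 (cell_values A vs $ l) (cell_values A v $ l)"
  unfolding sign_switch_eq_pressure[symmetric] pressure_modes_def dvs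
  by (simp add: cell_values_add cell_values_diff cell_values_scaleR cell_values_galerkin_prod[OF haar]
      cell_values_sign_modes[OF haar] cell_values_power_modes[OF haar] cell_values_e1[OF haar]
      cell_values_pressure_jump)

lemma flux_modes_eq:
  "flux_modes A \<gamma>\<^sub>1 \<gamma>\<^sub>2 vs dvs w =
     stack ((1 / real CARD('n)) *\<^sub>R
        (A *v (\<chi> l. pressure \<gamma>\<^sub>1 \<gamma>\<^sub>2 (cell_values A vs $ l) (cell_values A (vblock w) $ l)))) (- ublock w)"
proof -
  have "(\<chi> l. pressure \<gamma>\<^sub>1 \<gamma>\<^sub>2 (cell_values A vs $ l) (cell_values A (vblock w) $ l)) =
      cell_values A (pressure_modes A \<gamma>\<^sub>1 \<gamma>\<^sub>2 vs dvs (vblock w))"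
    by (simp add: vec_eq_iff cell_values_pressure_modes)
  then show ?thesis
    by (simp add: flux_modes_def mult_cell_values[OF haar])
qed

text \<open>The pressure of the expanded state is constant in every cell, and so is the sign switch;
  projecting it therefore reproduces the formula without truncation error.\<close>

lemma projected_flux_eq: "projected_flux A (random_flux A \<gamma>\<^sub>1 \<gamma>\<^sub>2 vs) w = flux_modes A \<gamma>\<^sub>1 \<gamma>\<^sub>2 vs dvs w"
proof -
  have "modes A (\<lambda>\<xi>. pressure \<gamma>\<^sub>1 \<gamma>\<^sub>2 (expansion A vs \<xi>) (expansion A (vblock w) \<xi>)) =
      (1 / real CARD('n)) *\<^sub>R
        (A *v (\<chi> l. pressure \<gamma>\<^sub>1 \<gamma>\<^sub>2 (cell_values A vs $ l) (cell_values A (vblock w) $ l)))"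
    by (rule modes_step) (simp only: expansion_cell vec_lambda_beta)
  moreover have "modes A (\<lambda>\<xi>. - expansion A (ublock w) \<xi>) = - ublock w"
  proof -
    have "cell_values A (modes A (\<lambda>\<xi>. - expansion A (ublock w) \<xi>)) = - cell_values A (ublock w)"
      by (rule cell_values_modes[OF haar]) (simp only: expansion_cell vector_uminus_component)
    also have "\<dots> = cell_values A (- ublock w)"
      using cell_values_scaleR[of A "-1" "ublock w"] by simp
    finally show ?thesis by (simp only: cell_values_inject[OF haar])
  qed
  ultimately show ?thesis
    by (simp add: projected_flux_def state_modes_def random_flux_def flux_def state_expansion_def
        flux_modes_eq)
qed

end

text \<open>Testing the expanded state with the orthonormal basis returns its modes, so the time
  derivative enters the Galerkin system without a mass matrix.\<close>

lemma state_modes_expansion: "state_modes A (state_expansion A w) = w"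
  by (simp add: state_modes_def state_expansion_def modes_expansion[OF haar])

end

theorem corollary3:
  fixes A :: "'n::{finite,linorder} rmat"
    and \<gamma>\<^sub>1 \<gamma>\<^sub>2 :: real
    and vs dvs :: "'n rvec"
  assumes haar: "haar_type A"
    and vs_pos: "AE \<xi> in unif01. expansion A vs \<xi> > 0"
    and pressure: "AE \<xi> in unif01. admissible_pressure \<gamma>\<^sub>1 \<gamma>\<^sub>2 (expansion A vs \<xi>)"
    and dvs: "dvs = modes A (\<lambda>\<xi>. pressure_jump \<gamma>\<^sub>1 \<gamma>\<^sub>2 (expansion A vs \<xi>))"
  shows
    "(\<forall>w. vblock w \<in> Hplus A \<longrightarrow>
        projected_flux A (random_flux A \<gamma>\<^sub>1 \<gamma>\<^sub>2 vs) w = flux_modes A \<gamma>\<^sub>1 \<gamma>\<^sub>2 vs dvs w) \<and>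
     (\<forall>\<Omega> U. open \<Omega> \<and> (\<forall>(t, x) \<in> \<Omega>. vblock (U t x) \<in> Hplus A) \<longrightarrow>
        (galerkin_system A (random_flux A \<gamma>\<^sub>1 \<gamma>\<^sub>2 vs) \<Omega> U \<longleftrightarrow>
         conservation_eq \<Omega> U (\<lambda>t x. flux_modes A \<gamma>\<^sub>1 \<gamma>\<^sub>2 vs dvs (U t x)))) \<and>
     (\<forall>w. vblock w \<in> Hplus A \<longrightarrow>
        spectrum_of ` gen_jacobian (flux_modes A \<gamma>\<^sub>1 \<gamma>\<^sub>2 vs dvs) w =
          (\<lambda>s. pm_diag (Dp_half A \<gamma>\<^sub>1 \<gamma>\<^sub>2 s (vblock w))) ` gen_sign_modes A (vblock w - vs) \<and>
        pm_diag (Dp_half A \<gamma>\<^sub>1 \<gamma>\<^sub>2 (sign_modes A (vblock w - vs)) (vblock w))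
          \<in> spectrum_of ` gen_jacobian (flux_modes A \<gamma>\<^sub>1 \<gamma>\<^sub>2 vs dvs) w) \<and>
     (\<forall>w. vblock w \<in> Hplus A \<and> (\<forall>i. eig_matrix A (vblock w - vs) $ i $ i \<noteq> 0) \<longrightarrow>
        flux_modes A \<gamma>\<^sub>1 \<gamma>\<^sub>2 vs dvs differentiable (at w) \<and>
        gen_jacobian (flux_modes A \<gamma>\<^sub>1 \<gamma>\<^sub>2 vs dvs) w =
          {jacobian (flux_modes A \<gamma>\<^sub>1 \<gamma>\<^sub>2 vs dvs) (at w)} \<and>
        spectrum_of (jacobian (flux_modes A \<gamma>\<^sub>1 \<gamma>\<^sub>2 vs dvs) (at w)) =
          pm_diag (Dp_half A \<gamma>\<^sub>1 \<gamma>\<^sub>2 (sign_modes A (vblock w - vs)) (vblock w)))"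
proof -
  let ?f = "flux_modes A \<gamma>\<^sub>1 \<gamma>\<^sub>2 vs dvs"
  let ?b = "cell_values A vs" and ?S = "(1 / real CARD('n)) *\<^sub>R A" and ?R = "transpose A"
  have b_pos: "0 < ?b $ l" for l
    using AE_expansion_imp_cell_values[OF vs_pos] .
  have adm: "admissible_pressure \<gamma>\<^sub>1 \<gamma>\<^sub>2 (?b $ l)" for l
    using AE_expansion_imp_cell_values[OF pressure] .
  interpret W: diagonalized_wave \<gamma>\<^sub>1 \<gamma>\<^sub>2 ?b ?S ?R
  proof
    show "?S ** ?R = mat 1" "?R ** ?S = mat 1"
      by (simp_all add: haar_type_orthogonal[OF haar] matrix_scalar_ac scalar_matrix_assoc[symmetric])
    show "0 < \<gamma>\<^sub>1" "0 < \<gamma>\<^sub>2" using admissible_pressureD[OF adm b_pos] by blast+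
    show "0 < ?b $ l" "power_slope \<gamma>\<^sub>1 (?b $ l) < power_slope \<gamma>\<^sub>2 (?b $ l)" for l
      using b_pos admissible_pressureD(3)[OF adm b_pos] by blast+
  qed
  have y: "W.y w = cell_values A (vblock w)" for w
    by (simp add: W.y_def cell_values_def)
  have f: "?f = W.F"
    by (rule ext) (simp add: flux_modes_eq[OF haar dvs] W.F_def y scaleR_matrix_vector_assoc)
  have pos: "0 < W.y w $ l" if "vblock w \<in> Hplus A" for w l
    using Hplus_cell_values_pos[OF haar that] by (simp add: y)
  have projected: "projected_flux A (random_flux A \<gamma>\<^sub>1 \<gamma>\<^sub>2 vs) = ?f"
    by (rule ext) (rule projected_flux_eq[OF haar dvs])
  have system: "galerkin_system A (random_flux A \<gamma>\<^sub>1 \<gamma>\<^sub>2 vs) \<Omega> U \<longleftrightarrow>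
      conservation_eq \<Omega> U (\<lambda>t x. ?f (U t x))" for \<Omega> U
    by (simp add: galerkin_system_def projected state_modes_expansion[OF haar])
  have spectrum: "spectrum_of ` gen_jacobian ?f w =
      (\<lambda>s. pm_diag (Dp_half A \<gamma>\<^sub>1 \<gamma>\<^sub>2 s (vblock w))) ` gen_sign_modes A (vblock w - vs)"
    if "vblock w \<in> Hplus A" for w
  proof -
    let ?G = "{\<sigma>. \<forall>l. \<sigma> $ l \<in> gen_sgn (W.y w $ l - ?b $ l)}"
    have "?G = cell_values A ` gen_sign_modes A (vblock w - vs)"
    proof (intro equalityI subsetI)
      fix \<sigma> assume "\<sigma> \<in> ?G"
      \<comment> \<open>Every vector of signs is the cell value vector of some modes, so the signs
        required for the spectrum are all realised.\<close>
      moreover have "\<sigma> = cell_values A (?S *v \<sigma>)"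
        by (simp add: scaleR_matrix_vector_assoc[symmetric] cell_values_scaleR cell_values_mult[OF haar])
      ultimately show "\<sigma> \<in> cell_values A ` gen_sign_modes A (vblock w - vs)"
        by (intro image_eqI[of _ _ "?S *v \<sigma>"]) (simp_all add: gen_sign_modes_iff[OF haar] y cell_values_diff)
    qed (auto simp: gen_sign_modes_iff[OF haar] y cell_values_diff)
    then show ?thesis
      using W.spectrum_gen_jacobian[OF pos[OF that]]
      by (simp add: f image_image pm_diag_def Dp_half_nth[OF haar] y)
  qed
  have selected: "pm_diag (Dp_half A \<gamma>\<^sub>1 \<gamma>\<^sub>2 (sign_modes A (vblock w - vs)) (vblock w))
      \<in> spectrum_of ` gen_jacobian ?f w" if "vblock w \<in> Hplus A" for w
    unfolding spectrum[OF that] by (rule imageI) (rule sign_modes_in_gen_sign_modes[OF haar])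
  have smooth: "?f differentiable (at w)" "gen_jacobian ?f w = {jacobian ?f (at w)}"
    if "vblock w \<in> Hplus A" "\<And>i. eig_matrix A (vblock w - vs) $ i $ i \<noteq> 0" for w
  proof -
    have "W.y w $ l \<noteq> ?b $ l" for l
      using that(2)[of l] by (simp add: eig_matrix_nth[OF haar] cell_values_diff y)
    then show "?f differentiable (at w)" "gen_jacobian ?f w = {jacobian ?f (at w)}"
      unfolding f using W.jacobian_F(1)[OF pos] W.gen_jacobian_no_kink[OF pos] that(1) by blast+
  qed
  have smooth_spectrum: "spectrum_of (jacobian ?f (at w)) =
      pm_diag (Dp_half A \<gamma>\<^sub>1 \<gamma>\<^sub>2 (sign_modes A (vblock w - vs)) (vblock w))"
    if "vblock w \<in> Hplus A" "\<And>i. eig_matrix A (vblock w - vs) $ i $ i \<noteq> 0" for w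
    \<comment> \<open>Membership in the image of a singleton is equality.\<close>
    using selected[OF that(1)] smooth(2)[OF that] by simp
  show ?thesis
  proof (intro conjI allI impI; (elim conjE)?)
    show "projected_flux A (random_flux A \<gamma>\<^sub>1 \<gamma>\<^sub>2 vs) w = ?f w" for w
      by (simp only: projected)
  qed (rule system spectrum selected smooth smooth_spectrum; blast)+
qed

end
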